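(* Let $(b,c)$ be a uniformly transient (connected) graph over the countably infinite set $X$. Let $m$ be a measure on $X$ of full support and let $L=L_m^{(D)}$ be the operator associated to $Q_m^{(D)}$. Then the associated semigroup $e^{-tL}$, $t>0$, and the resolvents $(L+\alpha)^{-1}$, $\alpha>0$, are ultracontractive, i.e. each of these operators is a bounded operator from $\ell^2(X,m)$ to $\ell^\infty(X)$.
   Context: $X$ is a countably infinite set, $C(X)$ the real-valued functions on $X$, $C_c(X)$ those with finite support, $\ell^\infty(X)$ the bounded ones, $\|f\|_\infty=\sup_X|f|$, and $C_0(X)$ is the closure of $C_c(X)$ with respect to $\|\cdot\|_\infty$. A graph $(b,c)$ over $X$ consists of a symmetric $b:X\times X\to[0,\infty)$ with zero diagonal and $\sum_{y}b(x,y)<\infty$ for all $x$, and an arbitrary $c:X\to[0,\infty)$. It is connected if for any two distinct $x,y\in X$ there are $x=x_0,\dots,x_n=y$ with $b(x_{i-1},x_i)>0$ for $i=1,\dots,n$. For $f\in C(X)$ put $\widetilde Q(f)=\frac12\sum_{x,y}b(x,y)|f(x)-f(y)|^2+\sum_x c(x)|f(x)|^2\in[0,\infty]$ and $\widetilde D=\{f\in C(X):\widetilde Q(f)<\infty\}$, with $\widetilde Q(f,g)$ the associated bilinear form on $\widetilde D$. For $o\in X$ put $\|f\|_o=(\widetilde Q(f)+|f(o)|^2)^{1/2}$; $\widetilde D_0$ is the closure of $C_c(X)$ in $\widetilde D$ with respect to $\|\cdot\|_o$ (independent of $o$ for connected graphs). A connected graph is uniformly transient if $\widetilde D_0\subseteq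 C_0(X)$. A measure $m$ of full support is given by $m:X\to(0,\infty)$ via $m(A)=\sum_{x\in A}m(x)$. $D(Q_m^{(D)})$ is the closure of $C_c(X)$ in $\widetilde D\cap\ell^2(X,m)$ with respect to $u\mapsto(\widetilde Q(u)+\|u\|_{\ell^2(X,m)}^2)^{1/2}$, and $Q_m^{(D)}$ is the restriction of $\widetilde Q$ to it. $L=L_m^{(D)}$ is the unique (non-negative) selfadjoint operator on $\ell^2(X,m)$ with $D(L)\subseteq D(Q_m^{(D)})$ and $\langle Lf,g\rangle=Q_m^{(D)}(f,g)$ for all $f\in D(L)$, $g\in D(Q_m^{(D)})$. *)

theory Defs
  imports "HOL-Analysis.Analysis"
begin

text \<open>The countably infinite set \<open>X\<close> is the universe of the type \<open>'a\<close>. As \<open>'a \<Rightarrow> real\<close> carries no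
  vector space or norm instance, function spaces are sets of functions, and operators on
  them are pairs of a domain \<open>D\<close> and a map \<open>A\<close> whose values off \<open>D\<close> are irrelevant.\<close>

definition graph :: "('a \<Rightarrow> 'a \<Rightarrow> real) \<Rightarrow> ('a \<Rightarrow> real) \<Rightarrow> bool" where
  "graph b c \<longleftrightarrow>
     (\<forall>x y. b x y \<ge> 0) \<and> (\<forall>x y. b x y = b y x) \<and> (\<forall>x. b x x = 0) \<and>
     (\<forall>x. (\<lambda>y. b x y) summable_on UNIV) \<and> (\<forall>x. c x \<ge> 0)"

definition connected_graph :: "('a \<Rightarrow> 'a \<Rightarrow> real) \<Rightarrow> bool" where
  "connected_graph b \<longleftrightarrow>
     (\<forall>x y. x \<noteq> y \<longrightarrow>
        (\<exists>n (p :: nat \<Rightarrow> 'a). p 0 = x \<and> p n = y \<and> (\<forall>i\<in>{1..n}. b (p (i - 1)) (p i) > 0)))"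

definition Cc :: "('a \<Rightarrow> real) set" where
  "Cc = {f. finite {x. f x \<noteq> 0}}"

definition ell_inf :: "('a \<Rightarrow> real) set" where
  "ell_inf = {f. bounded (range f)}"

text \<open>The supremum is meaningful only for members of \<open>ell_inf\<close>.\<close>

definition sup_norm :: "('a \<Rightarrow> real) \<Rightarrow> real" where
  "sup_norm f = (SUP x. \<bar>f x\<bar>)"

definition C0 :: "('a \<Rightarrow> real) set" where
  "C0 = {f \<in> ell_inf. \<forall>e>0. \<exists>g\<in>Cc. sup_norm (\<lambda>x. f x - g x) < e}"

definition ell2 :: "('a \<Rightarrow> real) \<Rightarrow> ('a \<Rightarrow> real) set" where
  "ell2 m = {f. (\<lambda>x. m x * (f x)\<^sup>2) summable_on UNIV}"

definition l2_inner :: "('a \<Rightarrow> real) \<Rightarrow> ('a \<Rightarrow> real) \<Rightarrow> ('a \<Rightarrow> real) \<Rightarrow> real" where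
  "l2_inner m f g = (\<Sum>\<^sub>\<infinity>x. m x * f x * g x)"

definition l2_norm :: "('a \<Rightarrow> real) \<Rightarrow> ('a \<Rightarrow> real) \<Rightarrow> real" where
  "l2_norm m f = sqrt (l2_inner m f f)"

definition energy :: "('a \<Rightarrow> 'a \<Rightarrow> real) \<Rightarrow> ('a \<Rightarrow> real) \<Rightarrow> ('a \<Rightarrow> real) \<Rightarrow> ennreal" where
  "energy b c f =
     (\<Sum>\<^sub>\<infinity>(x, y)\<in>UNIV. ennreal (b x y * (f x - f y)\<^sup>2)) / 2 +
     (\<Sum>\<^sub>\<infinity>x\<in>UNIV. ennreal (c x * (f x)\<^sup>2))"

definition finite_energy :: "('a \<Rightarrow> 'a \<Rightarrow> real) \<Rightarrow> ('a \<Rightarrow> real) \<Rightarrow> ('a \<Rightarrow> real) set" where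
  "finite_energy b c = {f. energy b c f < \<infinity>}"

text \<open>The bilinear form obtained from \<open>energy\<close> by polarization; both sums converge
  absolutely for functions of finite energy.\<close>

definition energy_form ::
  "('a \<Rightarrow> 'a \<Rightarrow> real) \<Rightarrow> ('a \<Rightarrow> real) \<Rightarrow> ('a \<Rightarrow> real) \<Rightarrow> ('a \<Rightarrow> real) \<Rightarrow> real" where
  "energy_form b c f g =
     (\<Sum>\<^sub>\<infinity>(x, y)\<in>UNIV. b x y * (f x - f y) * (g x - g y)) / 2 +
     (\<Sum>\<^sub>\<infinity>x\<in>UNIV. c x * f x * g x)"

definition pointed_norm ::
  "('a \<Rightarrow> 'a \<Rightarrow> real) \<Rightarrow> ('a \<Rightarrow> real) \<Rightarrow> 'a \<Rightarrow> ('a \<Rightarrow> real) \<Rightarrow> real" where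
  "pointed_norm b c p f = sqrt (enn2real (energy b c f) + \<bar>f p\<bar>\<^sup>2)"

definition finite_energy0 ::
  "('a \<Rightarrow> 'a \<Rightarrow> real) \<Rightarrow> ('a \<Rightarrow> real) \<Rightarrow> 'a \<Rightarrow> ('a \<Rightarrow> real) set" where
  "finite_energy0 b c p =
     {f \<in> finite_energy b c. \<forall>e>0. \<exists>g\<in>Cc. pointed_norm b c p (\<lambda>x. f x - g x) < e}"

text \<open>On a connected graph \<open>finite_energy0 b c p\<close> does not depend on the base point \<open>p\<close>, so
  requiring the inclusion for some \<open>p\<close> or for all \<open>p\<close> is the same.\<close>

definition uniformly_transient :: "('a \<Rightarrow> 'a \<Rightarrow> real) \<Rightarrow> ('a \<Rightarrow> real) \<Rightarrow> bool" where
  "uniformly_transient b c \<longleftrightarrow> connected_graph b \<and> (\<exists>p. finite_energy0 b c p \<subseteq> C0)"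

definition dirichlet_norm ::
  "('a \<Rightarrow> 'a \<Rightarrow> real) \<Rightarrow> ('a \<Rightarrow> real) \<Rightarrow> ('a \<Rightarrow> real) \<Rightarrow> ('a \<Rightarrow> real) \<Rightarrow> real" where
  "dirichlet_norm b c m f = sqrt (enn2real (energy b c f) + (l2_norm m f)\<^sup>2)"

definition dirichlet_domain ::
  "('a \<Rightarrow> 'a \<Rightarrow> real) \<Rightarrow> ('a \<Rightarrow> real) \<Rightarrow> ('a \<Rightarrow> real) \<Rightarrow> ('a \<Rightarrow> real) set" where
  "dirichlet_domain b c m =
     {f \<in> finite_energy b c \<inter> ell2 m.
        \<forall>e>0. \<exists>g\<in>Cc. dirichlet_norm b c m (\<lambda>x. f x - g x) < e}"

definition linear_on_space ::
  "('a \<Rightarrow> real) set \<Rightarrow> (('a \<Rightarrow> real) \<Rightarrow> 'a \<Rightarrow> real) \<Rightarrow> bool" where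
  "linear_on_space V A \<longleftrightarrow>
     (\<forall>f\<in>V. \<forall>g\<in>V. \<forall>r s. (\<lambda>x. r * f x + s * g x) \<in> V \<and>
        A (\<lambda>x. r * f x + s * g x) = (\<lambda>x. r * A f x + s * A g x))"

definition bounded_operator ::
  "('a \<Rightarrow> real) set \<Rightarrow> (('a \<Rightarrow> real) \<Rightarrow> real) \<Rightarrow> ('a \<Rightarrow> real) set \<Rightarrow> (('a \<Rightarrow> real) \<Rightarrow> real) \<Rightarrow>
   (('a \<Rightarrow> real) \<Rightarrow> 'a \<Rightarrow> real) \<Rightarrow> bool" where
  "bounded_operator V normV W normW A \<longleftrightarrow>
     linear_on_space V A \<and> A ` V \<subseteq> W \<and> (\<exists>K. \<forall>f\<in>V. normW (A f) \<le> K * normV f)"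

definition ultracontractive ::
  "('a \<Rightarrow> real) \<Rightarrow> (('a \<Rightarrow> real) \<Rightarrow> 'a \<Rightarrow> real) \<Rightarrow> bool" where
  "ultracontractive m A \<longleftrightarrow> bounded_operator (ell2 m) (l2_norm m) ell_inf sup_norm A"

definition adjoint_graph ::
  "('a \<Rightarrow> real) \<Rightarrow> ('a \<Rightarrow> real) set \<Rightarrow> (('a \<Rightarrow> real) \<Rightarrow> 'a \<Rightarrow> real) \<Rightarrow>
   (('a \<Rightarrow> real) \<times> ('a \<Rightarrow> real)) set" where
  "adjoint_graph m D A =
     {(f, h). f \<in> ell2 m \<and> h \<in> ell2 m \<and> (\<forall>g\<in>D. l2_inner m f (A g) = l2_inner m h g)}"

definition selfadjoint_operator ::
  "('a \<Rightarrow> real) \<Rightarrow> ('a \<Rightarrow> real) set \<Rightarrow> (('a \<Rightarrow> real) \<Rightarrow> 'a \<Rightarrow> real) \<Rightarrow> bool" where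
  "selfadjoint_operator m D A \<longleftrightarrow>
     D \<subseteq> ell2 m \<and> A ` D \<subseteq> ell2 m \<and> linear_on_space D A \<and>
     (\<forall>f\<in>ell2 m. \<forall>e>0. \<exists>g\<in>D. l2_norm m (\<lambda>x. f x - g x) < e) \<and>
     adjoint_graph m D A = {(f, A f) | f. f \<in> D}"

text \<open>Non-negativity is not listed: it follows from \<open>\<langle>Lf, f\<rangle> = energy_form b c f f \<ge> 0\<close>.\<close>

definition dirichlet_operator ::
  "('a \<Rightarrow> 'a \<Rightarrow> real) \<Rightarrow> ('a \<Rightarrow> real) \<Rightarrow> ('a \<Rightarrow> real) \<Rightarrow>
   ('a \<Rightarrow> real) set \<Rightarrow> (('a \<Rightarrow> real) \<Rightarrow> 'a \<Rightarrow> real) \<Rightarrow> bool" where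
  "dirichlet_operator b c m D L \<longleftrightarrow>
     selfadjoint_operator m D L \<and> D \<subseteq> dirichlet_domain b c m \<and>
     (\<forall>f\<in>D. \<forall>g\<in>dirichlet_domain b c m. l2_inner m (L f) g = energy_form b c f g)"

definition c0_semigroup ::
  "('a \<Rightarrow> real) \<Rightarrow> (real \<Rightarrow> ('a \<Rightarrow> real) \<Rightarrow> 'a \<Rightarrow> real) \<Rightarrow> bool" where
  "c0_semigroup m T \<longleftrightarrow>
     (\<forall>t\<ge>0. bounded_operator (ell2 m) (l2_norm m) (ell2 m) (l2_norm m) (T t)) \<and>
     (\<forall>f\<in>ell2 m. T 0 f = f) \<and>
     (\<forall>s\<ge>0. \<forall>t\<ge>0. \<forall>f\<in>ell2 m. T (s + t) f = T s (T t f)) \<and>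
     (\<forall>f\<in>ell2 m. ((\<lambda>t. l2_norm m (\<lambda>x. T t f x - f x)) \<longlongrightarrow> 0) (at_right 0))"

definition generator_graph ::
  "('a \<Rightarrow> real) \<Rightarrow> (real \<Rightarrow> ('a \<Rightarrow> real) \<Rightarrow> 'a \<Rightarrow> real) \<Rightarrow> (('a \<Rightarrow> real) \<times> ('a \<Rightarrow> real)) set" where
  "generator_graph m T =
     {(f, h). f \<in> ell2 m \<and> h \<in> ell2 m \<and>
        ((\<lambda>t. l2_norm m (\<lambda>x. (T t f x - f x) / t - h x)) \<longlongrightarrow> 0) (at_right 0)}"

text \<open>\<open>T t = e\<^sup>-\<^sup>t\<^sup>L\<close> for \<open>t \<ge> 0\<close>: the strongly continuous semigroup whose generator,
  including its domain, is \<open>-L\<close>. Such \<open>T\<close> is unique on \<open>ell2 m\<close>, and for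
  selfadjoint \<open>L \<ge> 0\<close> it exists and agrees with the spectral functional calculus.\<close>

definition exp_semigroup ::
  "('a \<Rightarrow> real) \<Rightarrow> ('a \<Rightarrow> real) set \<Rightarrow> (('a \<Rightarrow> real) \<Rightarrow> 'a \<Rightarrow> real) \<Rightarrow>
   (real \<Rightarrow> ('a \<Rightarrow> real) \<Rightarrow> 'a \<Rightarrow> real) \<Rightarrow> bool" where
  "exp_semigroup m D L T \<longleftrightarrow>
     c0_semigroup m T \<and> generator_graph m T = {(f, \<lambda>x. - L f x) | f. f \<in> D}"

definition shifted_operator ::
  "(('a \<Rightarrow> real) \<Rightarrow> 'a \<Rightarrow> real) \<Rightarrow> real \<Rightarrow> ('a \<Rightarrow> real) \<Rightarrow> 'a \<Rightarrow> real" where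
  "shifted_operator L \<alpha> f = (\<lambda>x. L f x + \<alpha> * f x)"

text \<open>\<open>(L + \<alpha>)\<^sup>-\<^sup>1\<close>; it is a genuine inverse on \<open>ell2 m\<close> when \<open>shifted_operator L \<alpha>\<close> maps \<open>D\<close>
  bijectively onto \<open>ell2 m\<close>.\<close>

definition resolvent ::
  "('a \<Rightarrow> real) set \<Rightarrow> (('a \<Rightarrow> real) \<Rightarrow> 'a \<Rightarrow> real) \<Rightarrow> real \<Rightarrow> ('a \<Rightarrow> real) \<Rightarrow> 'a \<Rightarrow> real" where
  "resolvent D L \<alpha> = the_inv_into D (shifted_operator L \<alpha>)"

end

theory Submission
  imports Defs
begin

text \<open>Convergence in the form norm implies convergence in the pointed norm, so the form domain lies
  in the closure of the finitely supported functions for the latter and hence, by uniform transience,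
  consists of bounded functions. As it is complete, uniform boundedness of the point evaluations
  gives \<open>sup \<bar>f\<bar> \<le> C (Q f + \<parallel>f\<parallel>\<^sup>2)\<^sup>1\<^sup>/\<^sup>2\<close>. It remains to bound the form norm by the
  \<open>\<ell>\<^sup>2\<close> norm of the argument on the ranges of the resolvent and of the semigroup; for the latter,
  \<open>2 t Q(T\<^sub>t f) \<le> \<parallel>f\<parallel>\<^sup>2\<close> holds for \<open>f\<close> in the operator domain and passes to all \<open>f\<close> by density.\<close>

section \<open>The Hilbert space of square summable functions\<close>

text \<open>Since sets of functions carry no norm, every estimate is made in an auxiliary type of
  square summable families. The form domain becomes a closed subspace of a product of three such
  spaces, holding the weighted differences, the part weighted by \<open>c\<close> and the part
  weighted by \<open>m\<close>; the last one determines the function. The semigroup is known only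
  through its generator, so its smoothing bound is obtained by differentiating along orbits.
  Spectrally the bound is \<open>(1 + 2 t \<lambda>) exp (- 2 t \<lambda>) \<le> 1\<close> for
  \<open>\<lambda> \<ge> 0\<close>, an instance of \<open>1 + x \<le> exp x\<close>. In the final
  density argument the inequality that is extended is the pointwise one, whose two sides depend
  continuously on the function. With \<open>C\<close> the constant of the embedding into bounded
  functions, the resulting constants are
  \<open>C * sqrt (1 / \<alpha> + 1 / \<alpha>\<^sup>2)\<close> for the resolvent and
  \<open>C * sqrt (1 / (2 * t) + 1)\<close> for the semigroup.\<close>

lemma square_summable_mult:
  fixes f g :: "'i \<Rightarrow> real"
  assumes "(\<lambda>i. (f i)\<^sup>2) summable_on A" "(\<lambda>i. (g i)\<^sup>2) summable_on A"
  shows "(\<lambda>i. f i * g i) summable_on A"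
proof -
  have "(\<lambda>i. (f i)\<^sup>2 + (g i)\<^sup>2) summable_on A"
    using assms by (rule summable_on_add)
  moreover have "\<bar>f i * g i\<bar> \<le> (f i)\<^sup>2 + (g i)\<^sup>2" for i
    using sum_squares_bound[of "\<bar>f i\<bar>" "\<bar>g i\<bar>"] abs_ge_zero[of "f i * g i"]
    unfolding abs_mult power2_abs by linarith
  ultimately have "(\<lambda>i. \<bar>f i * g i\<bar>) summable_on A"
    by (rule summable_on_comparison_test) auto
  then show ?thesis
    using summable_on_iff_abs_summable_on_real[of "\<lambda>i. f i * g i" A] by simp
qed

lemma square_summable_add:
  fixes f g :: "'i \<Rightarrow> real"
  assumes "(\<lambda>i. (f i)\<^sup>2) summable_on A" "(\<lambda>i. (g i)\<^sup>2) summable_on A"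
  shows "(\<lambda>i. (f i + g i)\<^sup>2) summable_on A"
proof -
  have "(\<lambda>i. (f i)\<^sup>2 + (g i)\<^sup>2 + 2 * (f i * g i)) summable_on A"
    using assms square_summable_mult[OF assms]
    by (intro summable_on_add summable_on_cmult_right)
  then show ?thesis
    by (simp add: power2_sum mult.assoc)
qed

lemma square_summable_scale:
  fixes f :: "'i \<Rightarrow> real"
  assumes "(\<lambda>i. (f i)\<^sup>2) summable_on A"
  shows "(\<lambda>i. (r * f i)\<^sup>2) summable_on A"
  using summable_on_cmult_right[OF assms, of "r\<^sup>2"] by (simp add: power_mult_distrib)

lemma square_summable_diff:
  fixes f g :: "'i \<Rightarrow> real"
  assumes "(\<lambda>i. (f i)\<^sup>2) summable_on A" "(\<lambda>i. (g i)\<^sup>2) summable_on A"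
  shows "(\<lambda>i. (f i - g i)\<^sup>2) summable_on A"
  using square_summable_add[OF assms(1) square_summable_scale[OF assms(2), of "-1"]] by simp

text \<open>The index type is arbitrary and there is no weight, so one type serves both vertices and
  ordered pairs of vertices; weights enter later through multiplication by square roots.\<close>

typedef 'i l2seq = "{f :: 'i \<Rightarrow> real. (\<lambda>i. (f i)\<^sup>2) summable_on UNIV}"
  morphisms coord l2seq
  by (rule exI[of _ "\<lambda>_. 0"]) simp

setup_lifting type_definition_l2seq

lemma coord_summable: "(\<lambda>i. (coord x i)\<^sup>2) summable_on UNIV"
  using coord[of x] by simp

lemma l2seq_eqI: "(\<And>i. coord x i = coord y i) \<Longrightarrow> x = y"
  by (simp add: coord_inject[symmetric] ext)

instantiation l2seq :: (type) real_inner
begin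

lift_definition zero_l2seq :: "'a l2seq" is "\<lambda>_. 0" by simp
lift_definition plus_l2seq :: "'a l2seq \<Rightarrow> 'a l2seq \<Rightarrow> 'a l2seq" is "\<lambda>f g i. f i + g i"
  by (rule square_summable_add)
lift_definition minus_l2seq :: "'a l2seq \<Rightarrow> 'a l2seq \<Rightarrow> 'a l2seq" is "\<lambda>f g i. f i - g i"
  by (rule square_summable_diff)
lift_definition uminus_l2seq :: "'a l2seq \<Rightarrow> 'a l2seq" is "\<lambda>f i. - f i" by simp
lift_definition scaleR_l2seq :: "real \<Rightarrow> 'a l2seq \<Rightarrow> 'a l2seq" is "\<lambda>r f i. r * f i"
  by (rule square_summable_scale)
lift_definition inner_l2seq :: "'a l2seq \<Rightarrow> 'a l2seq \<Rightarrow> real" is "\<lambda>f g. \<Sum>\<^sub>\<infinity>i. f i * g i" .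
definition "norm (x :: 'a l2seq) = sqrt (inner x x)"
definition "dist (x :: 'a l2seq) y = norm (x - y)"
definition "sgn (x :: 'a l2seq) = inverse (norm x) *\<^sub>R x"
definition [code del]: "(uniformity :: ('a l2seq \<times> 'a l2seq) filter) =
  (INF e\<in>{0<..}. principal {(x, y). dist x y < e})"
definition [code del]: "open (U :: 'a l2seq set) \<longleftrightarrow>
  (\<forall>x\<in>U. \<forall>\<^sub>F (x', y) in uniformity. x' = x \<longrightarrow> y \<in> U)"

instance
proof
  fix x y z :: "'a l2seq" and r s :: real
  show "x + y + z = x + (y + z)" "x + y = y + x" "0 + x = x" "- x + x = 0" "x - y = x + - y"
    by (transfer; simp add: ac_simps; fail)+
  show "r *\<^sub>R (x + y) = r *\<^sub>R x + r *\<^sub>R y" "(r + s) *\<^sub>R x = r *\<^sub>R x + s *\<^sub>R x"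
    "r *\<^sub>R s *\<^sub>R x = (r * s) *\<^sub>R x" "1 *\<^sub>R x = x"
    by (transfer; simp add: algebra_simps; fail)+
  show "inner x y = inner y x"
    by transfer (simp add: mult.commute)
  show "inner (x + y) z = inner x z + inner y z"
    by transfer (simp add: distrib_right infsum_add square_summable_mult)
  show "inner (r *\<^sub>R x) y = r * inner x y"
    by transfer (simp add: mult.assoc infsum_cmult_right')
  show "0 \<le> inner x x"
    by transfer (simp add: infsum_nonneg)
  show "inner x x = 0 \<longleftrightarrow> x = 0"
  proof transfer
    fix f :: "'a \<Rightarrow> real" assume f: "(\<lambda>i. (f i)\<^sup>2) summable_on UNIV"
    show "(\<Sum>\<^sub>\<infinity>i. f i * f i) = 0 \<longleftrightarrow> f = (\<lambda>_. 0)"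
    proof
      assume "(\<Sum>\<^sub>\<infinity>i. f i * f i) = 0"
      then have "f i * f i = 0" for i
        by (intro nonneg_infsum_le_0D[of "\<lambda>i. f i * f i" UNIV])
          (use f in \<open>auto simp: power2_eq_square\<close>)
      then show "f = (\<lambda>_. 0)" by auto
    qed auto
  qed
  show "norm x = sqrt (inner x x)" "dist x y = norm (x - y)" "sgn x = inverse (norm x) *\<^sub>R x"
    by (fact norm_l2seq_def dist_l2seq_def sgn_l2seq_def)+
  show "(uniformity :: ('a l2seq \<times> 'a l2seq) filter) =
      (INF e\<in>{0<..}. principal {(x, y). dist x y < e})"
    by (fact uniformity_l2seq_def)
  show "open U \<longleftrightarrow> (\<forall>x\<in>U. \<forall>\<^sub>F (x', y) in uniformity. x' = x \<longrightarrow> y \<in> U)"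
    for U :: "'a l2seq set"
    by (fact open_l2seq_def)
qed

end

lemma coord_simps [simp]:
  "coord 0 i = 0" "coord (x + y) i = coord x i + coord y i"
  "coord (x - y) i = coord x i - coord y i" "coord (- x) i = - coord x i"
  "coord (r *\<^sub>R x) i = r * coord x i"
  by (transfer; simp)+

lemma inner_l2seq_eq: "inner x y = (\<Sum>\<^sub>\<infinity>i. coord x i * coord y i)"
  by transfer simp

lemma sum_coord_le: "finite F \<Longrightarrow> (\<Sum>i\<in>F. (coord x i)\<^sup>2) \<le> (norm x)\<^sup>2"
  using finite_sum_le_infsum[OF coord_summable, of F x]
  by (simp add: power2_norm_eq_inner) (simp add: inner_l2seq_eq power2_eq_square)

lemma abs_coord_le: "\<bar>coord x i\<bar> \<le> norm x"
  using sum_coord_le[of "{i}" x] by (simp add: abs_le_square_iff[symmetric])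

lemma bounded_linear_coord: "bounded_linear (\<lambda>x. coord x i)"
  by (rule bounded_linear_intro[of _ 1]) (simp_all add: abs_coord_le)

text \<open>Bounds on finite partial sums survive coordinatewise limits, so the completeness proof
  never exchanges a limit with an infinite sum.\<close>

lemma norm_le_if_sum_coord_le:
  assumes "\<And>F. finite F \<Longrightarrow> (\<Sum>i\<in>F. (coord x i)\<^sup>2) \<le> K\<^sup>2" "K \<ge> 0"
  shows "norm x \<le> K"
proof -
  have "inner x x \<le> K\<^sup>2"
    unfolding inner_l2seq_eq using assms(1) coord_summable[of x]
    by (intro infsum_le_finite_sums) (auto simp: power2_eq_square)
  then show ?thesis
    using assms(2) by (simp add: norm_l2seq_def real_le_lsqrt)
qed

instance l2seq :: (type) complete_space
proof
  fix X :: "nat \<Rightarrow> 'a l2seq" assume X: "Cauchy X"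
  define f where "f i = lim (\<lambda>n. coord (X n) i)" for i
  have lim: "(\<lambda>n. coord (X n) i) \<longlonglongrightarrow> f i" for i
    using bounded_linear.Cauchy[OF bounded_linear_coord X] unfolding f_def
    by (simp add: Cauchy_convergent_iff convergent_LIMSEQ_iff)
  \<comment> \<open>For a fixed finite \<open>F\<close> the Cauchy estimate passes to the limit in
    \<open>k\<close> coordinate by coordinate. The index \<open>N\<close> is independent of
    \<open>F\<close>, which later allows the passage to all coordinates.\<close>
  have tail: "\<exists>N. \<forall>n\<ge>N. \<forall>F. finite F \<longrightarrow> (\<Sum>i\<in>F. (coord (X n) i - f i)\<^sup>2) \<le> e\<^sup>2" if "e > 0" for e
  proof -
    obtain N where N: "\<And>k n. k \<ge> N \<Longrightarrow> n \<ge> N \<Longrightarrow> norm (X n - X k) < e"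
      using X \<open>e > 0\<close> by (metis CauchyD)
    have "(\<Sum>i\<in>F. (coord (X n) i - f i)\<^sup>2) \<le> e\<^sup>2" if "n \<ge> N" "finite F" for n F
    proof (rule LIMSEQ_le_const2)
      show "(\<lambda>k. \<Sum>i\<in>F. (coord (X n) i - coord (X k) i)\<^sup>2) \<longlonglongrightarrow> (\<Sum>i\<in>F. (coord (X n) i - f i)\<^sup>2)"
        by (intro tendsto_intros lim)
      have "(\<Sum>i\<in>F. (coord (X n) i - coord (X k) i)\<^sup>2) \<le> e\<^sup>2" if "k \<ge> N" for k
      proof -
        have "(\<Sum>i\<in>F. (coord (X n) i - coord (X k) i)\<^sup>2) \<le> (norm (X n - X k))\<^sup>2"
          using sum_coord_le[OF \<open>finite F\<close>, of "X n - X k"] by simp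
        also have "\<dots> \<le> e\<^sup>2"
          using N[OF \<open>k \<ge> N\<close> \<open>n \<ge> N\<close>] by (simp add: power_mono)
        finally show ?thesis .
      qed
      then show "\<exists>N. \<forall>k\<ge>N. (\<Sum>i\<in>F. (coord (X n) i - coord (X k) i)\<^sup>2) \<le> e\<^sup>2" by blast
    qed
    then show ?thesis by blast
  qed
  obtain N where "\<And>F. finite F \<Longrightarrow> (\<Sum>i\<in>F. (coord (X N) i - f i)\<^sup>2) \<le> 1\<^sup>2"
    using tail[of 1] by auto
  \<comment> \<open>The limit \<open>f\<close> is square summable as the difference of
    \<open>X N\<close> and \<open>X N - f\<close>.\<close>
  then have "(\<lambda>i. (coord (X N) i - f i)\<^sup>2) summable_on UNIV"
    by (intro nonneg_bdd_above_summable_on bdd_aboveI2[of _ _ "1\<^sup>2"]) auto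
  then have "(\<lambda>i. (f i)\<^sup>2) summable_on UNIV"
    using square_summable_diff[OF coord_summable[of "X N"]] by fastforce
  then have f: "coord (l2seq f) = f"
    by (simp add: l2seq_inverse)
  have "X \<longlonglongrightarrow> l2seq f"
  proof (rule LIMSEQ_I)
    fix e :: real assume "e > 0"
    then obtain N where N: "\<And>n F. n \<ge> N \<Longrightarrow> finite F \<Longrightarrow>
        (\<Sum>i\<in>F. (coord (X n) i - f i)\<^sup>2) \<le> (e / 2)\<^sup>2"
      using tail[of "e / 2"] by auto
    have "norm (X n - l2seq f) \<le> e / 2" if "n \<ge> N" for n
      using N[OF that] \<open>e > 0\<close> by (intro norm_le_if_sum_coord_le) (auto simp: f)
    then show "\<exists>N. \<forall>n\<ge>N. norm (X n - l2seq f) < e"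
      using \<open>e > 0\<close> by (intro exI[of _ N]) (force intro: le_less_trans[of _ "e / 2"])
  qed
  then show "convergent X" by (rule convergentI)
qed

section \<open>Uniform boundedness, projections, selfadjoint operators and semigroups\<close>

text \<open>Nested balls: if no constant works, every ball centred in \<open>S\<close> contains a
  smaller one, again centred in \<open>S\<close>, on which some \<open>A i\<close> has norm at least
  \<open>n\<close>. The centres converge in the complete set \<open>S\<close> to a point of all the
  balls, where the family is unbounded. The balls live in the ambient space, and only their centres
  are kept in \<open>S\<close>.\<close>

lemma uniform_boundedness_on_subspace:
  fixes A :: "'i \<Rightarrow> 'a :: real_normed_vector \<Rightarrow> 'b :: real_normed_vector"
  assumes S: "complete S" "subspace S"
    and A: "\<And>i. bounded_linear (A i)"
    and bdd: "\<And>x. x \<in> S \<Longrightarrow> bounded (range (\<lambda>i. A i x))"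
  shows "\<exists>C>0. \<forall>i. \<forall>x\<in>S. norm (A i x) \<le> C * norm x"
proof (rule ccontr)
  assume contra: "\<not> ?thesis"
  interpret A: bounded_linear "A i" for i by (rule A)
  have step: "\<exists>z d. z \<in> S \<and> d > 0 \<and> d \<le> e / 2 \<and> cball z d \<subseteq> cball y e \<and>
      (\<exists>i. \<forall>w\<in>cball z d. norm (A i w) \<ge> real n)"
    if "y \<in> S" "e > 0" for y e n
  proof -
    \<comment> \<open>Chosen so that a vector of norm \<open>e / 2\<close> in the direction of
      \<open>x\<close> has an image of norm above \<open>e / 2 * C = n + 1\<close>.\<close>
    define C where "C = (2 * real n + 2) / e"
    have "C > 0" using \<open>e > 0\<close> by (simp add: C_def)
    then obtain i x where x: "x \<in> S" "norm (A i x) > C * norm x"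
      using contra by (meson not_le)
    have "x \<noteq> 0" using x(2) A.zero by auto
    define u where "u = (e / 2 / norm x) *\<^sub>R x"
    have u: "u \<in> S" "norm u = e / 2"
      using x(1) \<open>x \<noteq> 0\<close> \<open>e > 0\<close> S(2) by (auto simp: u_def subspace_scale)
    have "norm (A i u) = e / 2 / norm x * norm (A i x)"
      using \<open>e > 0\<close> by (simp add: u_def A.scaleR)
    also have "\<dots> > e / 2 / norm x * (C * norm x)"
      using x(2) \<open>x \<noteq> 0\<close> \<open>e > 0\<close> by (intro mult_strict_left_mono) auto
    also have "e / 2 / norm x * (C * norm x) = real n + 1"
      using \<open>x \<noteq> 0\<close> \<open>e > 0\<close> by (simp add: C_def field_simps)
    finally have big: "norm (A i u) > real n + 1" .
    \<comment> \<open>One of \<open>y + u\<close> and \<open>y - u\<close> is mapped at least as far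
      from the origin as \<open>u\<close>, whatever the image of \<open>y\<close> is.\<close>
    have "2 * norm (A i u) \<le> norm (A i (y + u)) + norm (A i (y - u))"
    proof -
      have "2 *\<^sub>R A i u = A i (y + u) - A i (y - u)"
        by (simp add: A.add A.diff scaleR_2)
      then have "norm (2 *\<^sub>R A i u) \<le> norm (A i (y + u)) + norm (A i (y - u))"
        by (metis norm_triangle_ineq4)
      then show ?thesis by simp
    qed
    then have "norm (A i (y + u)) > real n \<or> norm (A i (y - u)) > real n"
      using big by linarith
    then obtain z where z: "z = y + u \<or> z = y - u" "norm (A i z) > real n"
      by blast
    have zS: "z \<in> S" "dist y z = e / 2"
      using z(1) u S(2) \<open>y \<in> S\<close> by (auto simp: subspace_add subspace_diff dist_norm)
    have "open {w. norm (A i w) > real n}"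
      by (intro open_Collect_less continuous_intros A.continuous_on)
    then obtain d where d: "d > 0" "cball z d \<subseteq> {w. norm (A i w) > real n}"
      using z(2) open_contains_cball by (metis mem_Collect_eq)
    \<comment> \<open>As \<open>z\<close> has distance \<open>e / 2\<close> from \<open>y\<close>, a
      radius of at most \<open>e / 2\<close> keeps the new ball inside the old one; it also halves
      the radii, which makes the centres a Cauchy sequence.\<close>
    define d' where "d' = min d (e / 2)"
    have "cball z d' \<subseteq> cball y e"
    proof
      fix w assume "w \<in> cball z d'"
      then have "dist z w \<le> e / 2" by (simp add: d'_def)
      then show "w \<in> cball y e"
        using dist_triangle[of y w z] zS(2) by simp
    qed
    moreover have "\<forall>w\<in>cball z d'. norm (A i w) \<ge> real n"
    proof
      fix w assume "w \<in> cball z d'"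
      then have "w \<in> cball z d" by (simp add: d'_def)
      then show "norm (A i w) \<ge> real n" using d(2) by auto
    qed
    ultimately show ?thesis
      using zS(1) d(1) \<open>e > 0\<close> by (intro exI[of _ z] exI[of _ d']) (auto simp: d'_def)
  qed
  define P where "P n p \<longleftrightarrow> fst p \<in> S \<and> 0 < snd p \<and> snd p \<le> (1 / 2) ^ n"
    for n :: nat and p :: "'a \<times> real"
  define R where "R n p q \<longleftrightarrow> cball (fst q) (snd q) \<subseteq> cball (fst p) (snd p) \<and>
    (\<exists>i. \<forall>w\<in>cball (fst q) (snd q). norm (A i w) \<ge> real n)"
    for n :: nat and p q :: "'a \<times> real"
  have "\<exists>f. \<forall>n. P n (f n) \<and> R n (f n) (f (Suc n))"
  proof (rule dependent_nat_choice)
    show "\<exists>x. P 0 x"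
      using S(2) by (intro exI[of _ "(0, 1)"]) (auto simp: P_def subspace_0)
    fix p n assume "P n p"
    then have p: "fst p \<in> S" "snd p > 0" "snd p \<le> (1 / 2) ^ n"
      by (auto simp: P_def)
    obtain z d where zd: "z \<in> S" "d > 0" "d \<le> snd p / 2" "cball z d \<subseteq> cball (fst p) (snd p)"
        "\<exists>i. \<forall>w\<in>cball z d. norm (A i w) \<ge> real n"
      using step[OF p(1,2)] by metis
    have "P (Suc n) (z, d)"
      using zd(1-3) p(3) by (simp add: P_def)
    moreover have "R n p (z, d)"
      using zd(4,5) unfolding R_def fst_conv snd_conv by blast
    ultimately show "\<exists>q. P (Suc n) q \<and> R n p q" by blast
  qed
  then obtain f where f: "\<And>n. P n (f n)" "\<And>n. R n (f n) (f (Suc n))" by blast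
  define B where "B n = cball (fst (f n)) (snd (f n))" for n
  have "decseq B"
    by (rule decseq_SucI) (use f(2) in \<open>simp add: B_def R_def\<close>)
  have centre: "fst (f k) \<in> B n" if "n \<le> k" for n k
  proof -
    have "fst (f k) \<in> B k" using f(1)[of k] by (simp add: B_def P_def)
    then show ?thesis using decseqD[OF \<open>decseq B\<close> that] by blast
  qed
  have "Cauchy (\<lambda>n. fst (f n))"
  proof (rule metric_CauchyI)
    fix e :: real assume "e > 0"
    obtain N where N: "(1 / 2 :: real) ^ N < e / 2"
      using real_arch_pow_inv[of "e / 2" "1 / 2"] \<open>e > 0\<close> by auto
    have "dist (fst (f j)) (fst (f k)) < e" if "N \<le> j" "N \<le> k" for j k
    proof -
      have "dist (fst (f N)) (fst (f i)) < e / 2" if "N \<le> i" for i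
        using centre[OF that] f(1)[of N] N by (auto simp: B_def P_def)
      then show ?thesis
        using that by (metis dist_commute dist_triangle_half_l)
    qed
    then show "\<exists>N. \<forall>j\<ge>N. \<forall>k\<ge>N. dist (fst (f j)) (fst (f k)) < e" by blast
  qed
  then obtain w where w: "w \<in> S" "(\<lambda>n. fst (f n)) \<longlonglongrightarrow> w"
    using S(1)[unfolded complete_def, rule_format, of "\<lambda>n. fst (f n)"] f(1)
    by (auto simp: P_def)
  have "w \<in> B n" for n
  proof (rule Lim_in_closed_set[OF _ _ _ w(2)])
    show "closed (B n)" by (simp add: B_def)
    show "\<forall>\<^sub>F k in sequentially. fst (f k) \<in> B n"
      using centre by (rule eventually_sequentiallyI)
  qed simp
  then have "\<exists>i. norm (A i w) \<ge> real n" for n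
    using f(2)[of n] unfolding B_def R_def by blast
  moreover obtain K where "\<And>i. norm (A i w) \<le> K"
    using bdd[OF w(1)] unfolding bounded_iff by blast
  moreover obtain n where "K < real n"
    using reals_Archimedean2 by blast
  ultimately show False by (meson less_le_trans not_le)
qed

text \<open>The projection is a point of least distance to \<open>h\<close>: by the parallelogram
  identity a minimizing sequence is Cauchy, and the first variation at its limit vanishes in every
  direction of \<open>S\<close>.\<close>

lemma orthogonal_projection_exists:
  fixes S :: "'a :: {real_inner, complete_space} set"
  assumes "subspace S" "closed S"
  shows "\<exists>p\<in>S. \<forall>s\<in>S. inner (h - p) s = 0"
proof -
  have ne: "S \<noteq> {}" using assms(1) subspace_0 by blast
  define d where "d = infdist h S"
  have d: "d \<ge> 0" "\<And>s. s \<in> S \<Longrightarrow> d \<le> norm (h - s)"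
    by (auto simp: d_def infdist_nonneg infdist_le dist_norm[symmetric])
  have "\<exists>s\<in>S. (norm (h - s))\<^sup>2 < d\<^sup>2 + 1 / (real n + 1)" for n
  proof -
    have "d < sqrt (d\<^sup>2 + 1 / (real n + 1))"
      using d(1) by (intro real_less_rsqrt) simp
    then obtain s where "s \<in> S" "norm (h - s) < sqrt (d\<^sup>2 + 1 / (real n + 1))"
      using ne cINF_less_iff[of S "dist h"] unfolding d_def infdist_def
      by (auto simp: dist_norm bdd_below.I2[of _ 0] intro!: bdd_belowI2[of _ 0])
    then show ?thesis
      by (metis norm_ge_zero real_sqrt_less_iff real_sqrt_unique)
  qed
  then obtain s where s: "\<And>n. s n \<in> S" "\<And>n. (norm (h - s n))\<^sup>2 < d\<^sup>2 + 1 / (real n + 1)"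
    by metis
  \<comment> \<open>The midpoint lies in \<open>S\<close> and hence has distance at least
    \<open>d\<close> from \<open>h\<close>. In the parallelogram identity the multiples of
    \<open>d\<close> squared then cancel and only the errors remain.\<close>
  have para: "(norm (s j - s k))\<^sup>2 \<le> 2 * (1 / (real j + 1)) + 2 * (1 / (real k + 1))" for j k
  proof -
    have "(1 / 2) *\<^sub>R (s j + s k) \<in> S"
      using s(1) assms(1) by (simp add: subspace_add subspace_scale)
    then have "d\<^sup>2 \<le> (norm (h - (1 / 2) *\<^sub>R (s j + s k)))\<^sup>2"
      using d by (simp add: power_mono)
    moreover have "(norm (s j - s k))\<^sup>2 = 2 * (norm (h - s j))\<^sup>2 + 2 * (norm (h - s k))\<^sup>2
        - 4 * (norm (h - (1 / 2) *\<^sub>R (s j + s k)))\<^sup>2"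
      unfolding power2_norm_eq_inner
      by (simp add: inner_diff inner_add inner_commute algebra_simps)
    ultimately show ?thesis using s(2)[of j] s(2)[of k] by linarith
  qed
  have "Cauchy s"
  proof (rule metric_CauchyI)
    fix e :: real assume "e > 0"
    obtain N where N: "1 / (real N + 1) < e\<^sup>2 / 4"
      using reals_Archimedean[of "e\<^sup>2 / 4"] \<open>e > 0\<close> by (auto simp: inverse_eq_divide add.commute)
    have "dist (s j) (s k) < e" if "N \<le> j" "N \<le> k" for j k
    proof -
      have mono: "1 / (real i + 1) \<le> 1 / (real N + 1)" if "N \<le> i" for i
        using that by (simp add: frac_le)
      have "(norm (s j - s k))\<^sup>2 < e\<^sup>2"
        using para[of j k] mono[OF that(1)] mono[OF that(2)] N by linarith
      then show ?thesis
        using \<open>e > 0\<close> by (simp add: dist_norm power_less_imp_less_base)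
    qed
    then show "\<exists>N. \<forall>j\<ge>N. \<forall>k\<ge>N. dist (s j) (s k) < e" by blast
  qed
  then obtain p where p: "s \<longlonglongrightarrow> p"
    by (auto simp: Cauchy_convergent_iff convergent_def)
  have "p \<in> S" using closed_sequentially[OF assms(2) _ p] s(1) by blast
  have "(norm (h - p))\<^sup>2 \<le> d\<^sup>2 + 0"
  proof (rule LIMSEQ_le)
    show "(\<lambda>n. (norm (h - s n))\<^sup>2) \<longlonglongrightarrow> (norm (h - p))\<^sup>2"
      by (intro tendsto_intros p)
    have "(\<lambda>n. 1 / (real n + 1)) \<longlonglongrightarrow> 0"
      using LIMSEQ_inverse_real_of_nat by (simp add: inverse_eq_divide add.commute)
    then show "(\<lambda>n. d\<^sup>2 + 1 / (real n + 1)) \<longlonglongrightarrow> d\<^sup>2 + 0"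
      by (intro tendsto_intros)
  qed (use s(2) less_imp_le in blast)
  have "inner (h - p) v = 0" if "v \<in> S" for v
  proof (cases "v = 0")
    case False
    \<comment> \<open>This \<open>t\<close> minimizes the quadratic polynomial
      \<open>(norm (h - (p + t *\<^sub>R v)))\<^sup>2\<close>. Its minimum would lie below the least
      squared distance unless the inner product is zero.\<close>
    define t where "t = inner (h - p) v / (norm v)\<^sup>2"
    have "p + t *\<^sub>R v \<in> S"
      using \<open>p \<in> S\<close> that assms(1) by (simp add: subspace_add subspace_scale)
    then have "d\<^sup>2 \<le> (norm (h - (p + t *\<^sub>R v)))\<^sup>2"
      using d by (simp add: power_mono)
    also have "\<dots> = (norm (h - p))\<^sup>2 - 2 * t * inner (h - p) v + t\<^sup>2 * (norm v)\<^sup>2"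
      unfolding power2_norm_eq_inner
      by (simp add: inner_diff inner_add inner_commute algebra_simps power2_eq_square)
    also have "\<dots> = (norm (h - p))\<^sup>2 - (inner (h - p) v)\<^sup>2 / (norm v)\<^sup>2"
      using False by (simp add: t_def power2_eq_square field_simps)
    finally have "(inner (h - p) v)\<^sup>2 / (norm v)\<^sup>2 \<le> 0"
      using \<open>(norm (h - p))\<^sup>2 \<le> d\<^sup>2 + 0\<close> by linarith
    then show ?thesis
      using False by (simp add: divide_le_0_iff zero_less_power2 not_le)
  qed simp
  then show ?thesis using \<open>p \<in> S\<close> by blast
qed

text \<open>The range of \<open>L + \<alpha>\<close> is closed, because the lower bound
  \<open>\<alpha> * norm f\<close> makes preimages of Cauchy sequences Cauchy and an adjoint has a
  closed graph. Its orthogonal complement is the kernel of the adjoint \<open>L + \<alpha>\<close>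
  itself, which the same lower bound makes trivial. The hypothesis \<open>adj\<close> states in one
  equivalence that \<open>L\<close> equals its adjoint, domain included.\<close>

lemma shifted_selfadjoint_surj:
  fixes L :: "'a :: {real_inner, complete_space} \<Rightarrow> 'a"
  assumes lin: "\<And>f g r s. f \<in> D \<Longrightarrow> g \<in> D \<Longrightarrow>
        r *\<^sub>R f + s *\<^sub>R g \<in> D \<and> L (r *\<^sub>R f + s *\<^sub>R g) = r *\<^sub>R L f + s *\<^sub>R L g"
    and adj: "\<And>f h. (\<forall>g\<in>D. inner f (L g) = inner h g) \<longleftrightarrow> f \<in> D \<and> h = L f"
    and nonneg: "\<And>f. f \<in> D \<Longrightarrow> inner (L f) f \<ge> 0"
    and "\<alpha> > 0"
  shows "\<exists>f\<in>D. L f + \<alpha> *\<^sub>R f = h"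
proof -
  define M where "M f = L f + \<alpha> *\<^sub>R f" for f
  have zero: "0 \<in> D"
    using adj[of 0 0] by auto
  have M_lin: "r *\<^sub>R f + s *\<^sub>R g \<in> D" "M (r *\<^sub>R f + s *\<^sub>R g) = r *\<^sub>R M f + s *\<^sub>R M g"
    if "f \<in> D" "g \<in> D" for f g r s
    using lin[OF that] by (auto simp: M_def algebra_simps)
  have below: "\<alpha> * norm f \<le> norm (M f)" if "f \<in> D" for f
  proof -
    have "\<alpha> * norm f * norm f \<le> inner (M f) f"
      using nonneg[OF that]
      by (simp add: M_def inner_add_left power2_norm_eq_inner[symmetric] power2_eq_square)
    also have "\<dots> \<le> norm (M f) * norm f" by (rule norm_cauchy_schwarz)
    finally show ?thesis
      by (cases "f = 0") auto
  qed
  have sub: "subspace (M ` D)"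
  proof (rule subspaceI)
    show "0 \<in> M ` D"
      using zero lin[OF zero zero, of 0 0] by (auto simp: M_def image_iff intro!: bexI[of _ 0])
    show "x + y \<in> M ` D" if xy: "x \<in> M ` D" "y \<in> M ` D" for x y
    proof -
      obtain f g where "f \<in> D" "g \<in> D" "x = M f" "y = M g" using xy by blast
      then show ?thesis using M_lin[of f g 1 1] by (auto intro!: image_eqI[of _ _ "f + g"])
    qed
    show "r *\<^sub>R x \<in> M ` D" if x: "x \<in> M ` D" for r x
    proof -
      obtain f where "f \<in> D" "x = M f" using x by blast
      then show ?thesis using M_lin[of f f r 0] by (auto intro!: image_eqI[of _ _ "r *\<^sub>R f"])
    qed
  qed
  have "closed (M ` D)"
    unfolding closed_sequential_limits
  proof (intro allI impI, elim conjE)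
    fix y l assume y: "\<forall>n. y n \<in> M ` D" "y \<longlonglongrightarrow> l"
    then have "\<forall>n. \<exists>u. u \<in> D \<and> y n = M u" by blast
    then obtain u where u: "\<And>n. u n \<in> D" "\<And>n. y n = M (u n)"
      unfolding choice_iff by blast
    have "Cauchy u"
    proof (rule metric_CauchyI)
      fix e :: real assume "e > 0"
      have "Cauchy y" using y(2) by (rule LIMSEQ_imp_Cauchy)
      then obtain N where N: "\<And>j k. j \<ge> N \<Longrightarrow> k \<ge> N \<Longrightarrow> norm (y j - y k) < \<alpha> * e"
        using CauchyD[of y "\<alpha> * e"] \<open>e > 0\<close> \<open>\<alpha> > 0\<close> by auto
      have "dist (u j) (u k) < e" if "j \<ge> N" "k \<ge> N" for j k
      proof -
        have "\<alpha> * norm (u j - u k) \<le> norm (y j - y k)"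
          using below[of "u j - u k"] M_lin[OF u(1)[of j] u(1)[of k], of 1 "-1"] u(2) by simp
        also have "\<dots> < \<alpha> * e" using N that by simp
        finally show ?thesis using \<open>\<alpha> > 0\<close> by (simp add: dist_norm)
      qed
      then show "\<exists>N. \<forall>j\<ge>N. \<forall>k\<ge>N. dist (u j) (u k) < e" by blast
    qed
    then obtain f where f: "u \<longlonglongrightarrow> f"
      by (auto simp: Cauchy_convergent_iff convergent_def)
    \<comment> \<open>Closedness of the graph: tested against a fixed \<open>g\<close>, the adjoint
      equation passes to the limit, and \<open>adj\<close> then returns \<open>f\<close> to the
      domain.\<close>
    have "inner f (L g) = inner (l - \<alpha> *\<^sub>R f) g" if "g \<in> D" for g
    proof (rule LIMSEQ_unique)
      show "(\<lambda>n. inner (u n) (L g)) \<longlonglongrightarrow> inner f (L g)"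
        by (intro tendsto_intros f)
      have "inner (u n) (L g) = inner (y n - \<alpha> *\<^sub>R u n) g" for n
        using adj[of "u n" "L (u n)"] u that by (simp add: M_def)
      then show "(\<lambda>n. inner (u n) (L g)) \<longlonglongrightarrow> inner (l - \<alpha> *\<^sub>R f) g"
        by (simp only:) (intro tendsto_intros f y(2))
    qed
    then have "f \<in> D" "l = M f"
      using adj[of f "l - \<alpha> *\<^sub>R f"] by (auto simp: M_def algebra_simps)
    then show "l \<in> M ` D" by blast
  qed
  then obtain p where p: "p \<in> M ` D" "\<And>s. s \<in> M ` D \<Longrightarrow> inner (h - p) s = 0"
    using orthogonal_projection_exists[OF sub] by blast
  \<comment> \<open>Orthogonality of the residual to the range, read as an adjoint equation:
    \<open>h - p\<close> is an eigenvector of \<open>L\<close> for the value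
    \<open>- \<alpha>\<close> or zero.\<close>
  have "\<forall>g\<in>D. inner (h - p) (L g) = inner (- \<alpha> *\<^sub>R (h - p)) g"
  proof
    fix g assume "g \<in> D"
    then have "inner (h - p) (M g) = 0" using p(2) by blast
    then show "inner (h - p) (L g) = inner (- \<alpha> *\<^sub>R (h - p)) g"
      by (simp add: M_def inner_add_right)
  qed
  then have v: "h - p \<in> D" "L (h - p) = - \<alpha> *\<^sub>R (h - p)"
    using adj by metis+
  have "h - p = 0"
    using below[OF v(1)] v(2) \<open>\<alpha> > 0\<close> by (simp add: M_def mult_le_0_iff)
  then show ?thesis using p(1) by (auto simp: M_def)
qed

text \<open>The function \<open>s \<mapsto> \<parallel>T s f\<parallel>\<^sup>2 + 2 s \<langle>L (T s f), T s f\<rangle>\<close> is nonincreasing, with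
  derivative \<open>- 4 s \<parallel>L (T s f)\<parallel>\<^sup>2\<close>.\<close>

lemma semigroup_form_decay:
  fixes T :: "real \<Rightarrow> 'a :: {real_inner, complete_space} \<Rightarrow> 'a"
  assumes T: "\<And>t. t \<ge> 0 \<Longrightarrow> bounded_linear (T t)"
    and T0: "\<And>f. T 0 f = f"
    and Tadd: "\<And>s t f. s \<ge> 0 \<Longrightarrow> t \<ge> 0 \<Longrightarrow> T (s + t) f = T s (T t f)"
    and cont0: "\<And>f. ((\<lambda>t. T t f) \<longlongrightarrow> f) (at_right 0)"
    and gen: "\<And>f h. ((\<lambda>t. (T t f - f) /\<^sub>R t) \<longlongrightarrow> h) (at_right 0) \<longleftrightarrow> f \<in> D \<and> h = - L f"
    and sym: "\<And>f g. f \<in> D \<Longrightarrow> g \<in> D \<Longrightarrow> inner (L f) g = inner f (L g)"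
    and f: "f \<in> D" and "t \<ge> 0"
  shows "T t f \<in> D" "2 * t * inner (L (T t f)) (T t f) + (norm (T t f))\<^sup>2 \<le> (norm f)\<^sup>2"
proof -
  \<comment> \<open>The only continuity given is at time 0 from the right. If no interval had a
    uniform bound, times \<open>r n\<close> tending to 0 would give operators without common bound,
    although each \<open>T (r n) y\<close> converges to \<open>y\<close>.\<close>
  have local_bound: "\<exists>a>0. \<exists>K. \<forall>t\<in>{0..a}. \<forall>x. norm (T t x) \<le> K * norm x"
  proof (rule ccontr)
    assume contra: "\<not> ?thesis"
    have "\<exists>t\<in>{0..1 / real (Suc n)}. \<exists>x. norm (T t x) > real n * norm x" for n
    proof -
      have "(1 :: real) / real (Suc n) > 0" by simp
      then show ?thesis using contra by (meson not_le)
    qed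
    then obtain r x where r: "\<And>n. r n \<in> {0..1 / real (Suc n)}"
      and x: "\<And>n. norm (T (r n) (x n)) > real n * norm (x n)"
      by metis
    have "r \<longlonglongrightarrow> 0"
    proof (rule tendsto_sandwich[of "\<lambda>_. 0" _ _ "\<lambda>n. 1 / real (Suc n)"])
      show "(\<lambda>n. 1 / real (Suc n)) \<longlonglongrightarrow> 0" by (rule LIMSEQ_Suc[OF lim_1_over_n])
    qed (use r in auto)
    have "\<exists>C>0. \<forall>n. \<forall>y\<in>UNIV. norm (T (r n) y) \<le> C * norm y"
    proof (rule uniform_boundedness_on_subspace)
      show "bounded_linear (T (r n))" for n using T r by simp
      fix y :: 'a
      have "((\<lambda>t. T t y) \<longlongrightarrow> T 0 y) (at 0 within {0..})"
        using cont0[of y] T0 by (simp add: at_within_Ici_at_right)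
      then have "continuous (at 0 within {0..}) (\<lambda>t. T t y)"
        by (simp add: continuous_within)
      then have "(\<lambda>n. T (r n) y) \<longlonglongrightarrow> T 0 y"
        using \<open>r \<longlonglongrightarrow> 0\<close> r by (auto simp: continuous_within_sequentially comp_def)
      then show "bounded (range (\<lambda>n. T (r n) y))"
        by (rule convergent_imp_bounded)
    qed (auto simp: complete_UNIV)
    then obtain C where C: "\<And>n y. norm (T (r n) y) \<le> C * norm y" by blast
    obtain n where "real n > C" using reals_Archimedean2 by blast
    then have "norm (T (r n) (x n)) \<le> real n * norm (x n)"
      using C[of n "x n"] by (meson less_imp_le mult_right_mono norm_ge_zero order_trans)
    then show False using x[of n] by simp
  qed
  then obtain a K where a: "a > 0" and K: "\<And>s x. 0 \<le> s \<Longrightarrow> s \<le> a \<Longrightarrow> norm (T s x) \<le> K * norm x"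
    by (metis atLeastAtMost_iff)
  have bound: "\<exists>M\<ge>0. \<forall>s\<in>{0..B}. \<forall>x. norm (T s x) \<le> M * norm x" for B
  proof -
    have "norm (T s x) \<le> max 1 K ^ n * norm x" if "0 \<le> s" "s \<le> real n * a" for n s x
      using that
    proof (induction n arbitrary: s x)
      case 0
      then show ?case by (simp add: T0)
    next
      case (Suc n)
      show ?case
      proof (cases "s \<le> a")
        case True
        have "norm (T s x) \<le> max 1 K * norm x"
          using K[OF Suc.prems(1) True, of x] by (meson max.cobounded2 mult_right_mono norm_ge_zero order_trans)
        also have "\<dots> \<le> max 1 K ^ Suc n * norm x"
          by (intro mult_right_mono self_le_power) auto
        finally show ?thesis .
      next
        case False
        have "norm (T s x) = norm (T (s - a) (T a x))"
          using Tadd[of "s - a" a x] False a by simp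
        also have "\<dots> \<le> max 1 K ^ n * norm (T a x)"
          using Suc.prems False by (intro Suc.IH) (auto simp: algebra_simps)
        also have "\<dots> \<le> max 1 K ^ n * (max 1 K * norm x)"
          using K[of a x] a
          by (intro mult_left_mono) (auto intro: order_trans[OF _ mult_right_mono])
        finally show ?thesis by (simp add: ac_simps)
      qed
    qed
    moreover obtain n where "B < real n * a"
      using a reals_Archimedean3 by blast
    ultimately show ?thesis
      by (intro exI[of _ "max 1 K ^ n"]) auto
  qed
  have T_diff: "T s (x - y) = T s x - T s y" if "s \<ge> 0" for s x y
    using bounded_linear.linear[OF T[OF that]] by (rule linear_diff)
  have orbit_cont: "continuous_on {0..B} (\<lambda>s. T s g)" for B g
    unfolding continuous_on_def
  proof
    fix s assume s: "s \<in> {0..B}"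
    obtain M where M: "M \<ge> 0" "\<And>r x. r \<in> {0..B} \<Longrightarrow> norm (T r x) \<le> M * norm x"
      using bound[of B] by blast
    have est: "norm (T y g - T x g) \<le> M * norm (T (y - x) g - g)"
      if "x \<in> {0..B}" "x \<le> y" for x y
    proof -
      have "T y g - T x g = T x (T (y - x) g - g)"
        using that Tadd[of x "y - x" g] by (simp add: T_diff)
      then show ?thesis using M(2) that by simp
    qed
    \<comment> \<open>Since \<open>est\<close> always factors out the operator at the smaller time,
      the distance \<open>\<bar>y - s\<bar>\<close> treats left and right limits together.\<close>
    have "((\<lambda>y. T y g - T s g) \<longlongrightarrow> 0) (at s within {0..B})"
    proof (rule Lim_null_comparison)
      show "\<forall>\<^sub>F y in at s within {0..B}. norm (T y g - T s g) \<le> M * norm (T \<bar>y - s\<bar> g - g)"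
        using est[of s] est[of _ s] s
        by (auto simp: eventually_at_filter abs_if norm_minus_commute not_less
            intro!: always_eventually)
      have "filterlim (\<lambda>y. \<bar>y - s\<bar>) (at_right 0) (at s within {0..B})"
        unfolding filterlim_at by (auto simp: eventually_at_filter intro!: tendsto_eq_intros)
      then have "((\<lambda>y. T \<bar>y - s\<bar> g) \<longlongrightarrow> g) (at s within {0..B})"
        by (rule filterlim_compose[OF cont0])
      then show "((\<lambda>y. M * norm (T \<bar>y - s\<bar> g - g)) \<longlongrightarrow> 0) (at s within {0..B})"
        by (auto intro!: tendsto_eq_intros)
    qed
    then show "((\<lambda>y. T y g) \<longlongrightarrow> T s g) (at s within {0..B})"
      by (simp add: LIM_zero_iff)
  qed
  have TD: "T s g \<in> D" "L (T s g) = T s (L g)" if "g \<in> D" "s \<ge> 0" for s g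
  proof -
    \<comment> \<open>The bounded operator \<open>T s\<close> commutes with the difference quotient
      at 0. Hence the quotient of \<open>T s g\<close> converges too, and \<open>gen\<close>, read
      backwards, gives both membership in \<open>D\<close> and the value of
      \<open>L\<close>.\<close>
    have "((\<lambda>h. T s ((T h g - g) /\<^sub>R h)) \<longlongrightarrow> T s (- L g)) (at_right 0)"
      using gen[of g "- L g"] that by (intro bounded_linear.tendsto[OF T]) auto
    moreover have "\<forall>\<^sub>F h in at_right 0. T s ((T h g - g) /\<^sub>R h) = (T h (T s g) - T s g) /\<^sub>R h"
      unfolding eventually_at_filter
    proof (intro always_eventually allI impI)
      fix h :: real assume "h \<in> {0<..}"
      then have "T h (T s g) = T s (T h g)"
        using Tadd[of h s g] Tadd[of s h g] that by (simp add: add.commute)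
      then show "T s ((T h g - g) /\<^sub>R h) = (T h (T s g) - T s g) /\<^sub>R h"
        using that by (simp add: linear_scale[OF bounded_linear.linear[OF T]] T_diff)
    qed
    ultimately have "((\<lambda>h. (T h (T s g) - T s g) /\<^sub>R h) \<longlongrightarrow> T s (- L g)) (at_right 0)"
      by (rule Lim_transform_eventually)
    then have "T s g \<in> D \<and> T s (- L g) = - L (T s g)"
      using gen by blast
    then show "T s g \<in> D" "L (T s g) = T s (L g)"
      using that linear_neg[OF bounded_linear.linear[OF T[of s]], of "L g"] by auto
  qed
  have isCont: "isCont (\<lambda>s. T s g) s" if "s > 0" for s g
    using continuous_on_interior[OF orbit_cont[of "s + 1" g], of s] that by simp
  have quot: "((\<lambda>y. (T y g - T s g) /\<^sub>R (y - s)) \<longlongrightarrow> - T s (L g)) (at s)"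
    if "g \<in> D" "s > 0" for s g
  proof -
    obtain M where M: "M \<ge> 0" "\<And>r x. r \<in> {0..s} \<Longrightarrow> norm (T r x) \<le> M * norm x"
      using bound[of s] by blast
    define w where "w h = (T h g - g) /\<^sub>R h" for h
    have w: "(w \<longlongrightarrow> - L g) (at_right 0)"
      using gen[of g "- L g"] that by (simp add: w_def[abs_def])
    have pos: "\<forall>\<^sub>F y in at s. 0 < y \<and> y \<noteq> s"
      using \<open>s > 0\<close> eventually_at_in_open[of "{0<..}" s] by (auto elim!: eventually_mono)
    have "filterlim (\<lambda>y. \<bar>y - s\<bar>) (at_right 0) (at s)"
      unfolding filterlim_at by (auto simp: eventually_at_filter intro!: tendsto_eq_intros)
    from filterlim_compose[OF w this]
    have w': "((\<lambda>y. w \<bar>y - s\<bar> + L g) \<longlongrightarrow> 0) (at s)"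
      by (auto intro!: tendsto_eq_intros)
    \<comment> \<open>For \<open>y < s\<close> the operator in front of the quotient is
      \<open>T y\<close>, which moves with \<open>y\<close>. Adding and subtracting
      \<open>L g\<close> leaves a null sequence under operators bounded uniformly by
      \<open>M\<close>, plus an orbit that is already known to be continuous.\<close>
    have "((\<lambda>y. T (min y s) (w \<bar>y - s\<bar> + L g)) \<longlongrightarrow> 0) (at s)"
    proof (rule Lim_null_comparison)
      show "\<forall>\<^sub>F y in at s. norm (T (min y s) (w \<bar>y - s\<bar> + L g)) \<le> M * norm (w \<bar>y - s\<bar> + L g)"
        using pos by eventually_elim (rule M(2), use that(2) in auto)
      show "((\<lambda>y. M * norm (w \<bar>y - s\<bar> + L g)) \<longlongrightarrow> 0) (at s)"
        using tendsto_mult_right_zero[OF tendsto_norm_zero[OF w']] .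
    qed
    moreover have "((\<lambda>y. T (min y s) (L g)) \<longlongrightarrow> T s (L g)) (at s)"
      using isCont[OF \<open>s > 0\<close>, of "L g"]
      by (rule isCont_tendsto_compose) (auto intro!: tendsto_eq_intros)
    ultimately have "((\<lambda>y. T (min y s) (w \<bar>y - s\<bar> + L g) - T (min y s) (L g)) \<longlongrightarrow> 0 - T s (L g)) (at s)"
      by (rule tendsto_diff)
    moreover have "\<forall>\<^sub>F y in at s. T (min y s) (w \<bar>y - s\<bar> + L g) - T (min y s) (L g) =
        (T y g - T s g) /\<^sub>R (y - s)"
      using pos
    proof eventually_elim
      case (elim y)
      have scale: "T r ((T h g - g) /\<^sub>R h) = (T (r + h) g - T r g) /\<^sub>R h" if "r \<ge> 0" "h > 0" for r h
        using that Tadd[of r h g] by (simp add: linear_scale[OF bounded_linear.linear[OF T]] T_diff)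
      have "T (min y s) (w \<bar>y - s\<bar> + L g) - T (min y s) (L g) = T (min y s) (w \<bar>y - s\<bar>)"
        using elim \<open>s > 0\<close> linear_add[OF bounded_linear.linear[OF T[of "min y s"]]] by simp
      also have "\<dots> = (T y g - T s g) /\<^sub>R (y - s)"
      proof (cases "y < s")
        case True
        have "inverse (s - y) = - inverse (y - s)"
          by (simp flip: inverse_minus_eq)
        then have "(T s g - T y g) /\<^sub>R (s - y) = (T y g - T s g) /\<^sub>R (y - s)"
          by (simp add: scaleR_diff_right)
        then show ?thesis
          using True elim scale[of y "s - y"] by (simp add: w_def)
      next
        case False
        then show ?thesis
          using elim \<open>s > 0\<close> scale[of s "y - s"] by (simp add: w_def)
      qed
      finally show ?case .
    qed
    ultimately show ?thesis
      using Lim_transform_eventually by fastforce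
  qed
  show "T t f \<in> D" using TD f \<open>t \<ge> 0\<close> by blast
  define u v where "u s = T s f" and "v s = T s (L f)" for s
  have uD: "u s \<in> D" "L (u s) = v s" if "s \<ge> 0" for s
    using TD f that by (auto simp: u_def v_def)
  have cont: "(u \<longlongrightarrow> u s) (at s)" "(v \<longlongrightarrow> v s) (at s)" if "s > 0" for s
    using isCont[OF that] by (simp_all add: u_def[abs_def] v_def[abs_def] isCont_def)
  have uq: "((\<lambda>y. (u y - u s) /\<^sub>R (y - s)) \<longlongrightarrow> - v s) (at s)" if "s > 0" for s
    using quot[OF f that] by (simp add: u_def v_def)
  define F where "F s = (norm (u s))\<^sup>2 + 2 * s * inner (v s) (u s)" for s
  have n2: "((\<lambda>s. (norm (u s))\<^sup>2) has_real_derivative - 2 * inner (v s) (u s)) (at s)" if "s > 0" for s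
    unfolding has_field_derivative_iff
  proof -
    have "((norm (u y))\<^sup>2 - (norm (u s))\<^sup>2) / (y - s) =
        inner ((u y - u s) /\<^sub>R (y - s)) (u y + u s)" for y
      by (simp add: power2_norm_eq_inner inner_diff_left inner_diff_right inner_add_right inner_commute divide_inverse
          mult.commute)
    moreover have "((\<lambda>y. inner ((u y - u s) /\<^sub>R (y - s)) (u y + u s)) \<longlongrightarrow> - 2 * inner (v s) (u s)) (at s)"
      using tendsto_inner[OF uq[OF that] tendsto_add[OF cont(1)[OF that] tendsto_const[of "u s"]]]
      by (simp add: inner_add_right)
    ultimately show "((\<lambda>y. ((norm (u y))\<^sup>2 - (norm (u s))\<^sup>2) / (y - s)) \<longlongrightarrow> - 2 * inner (v s) (u s)) (at s)"
      by simp
  qed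
  \<comment> \<open>The curve \<open>v\<close> need not be differentiable, as \<open>L f\<close>
    need not lie in \<open>D\<close>. Symmetry of \<open>L\<close> replaces the mixed term
    \<open>inner (v y) (u s)\<close> by \<open>inner (u y) (v s)\<close>, so the quotient involves
    differences of \<open>u\<close> only.\<close>
  have q: "((\<lambda>s. inner (v s) (u s)) has_real_derivative - 2 * (norm (v s))\<^sup>2) (at s)" if "s > 0" for s
    unfolding has_field_derivative_iff
  proof -
    have "(inner (v y) (u y) - inner (v s) (u s)) / (y - s) =
        inner ((u y - u s) /\<^sub>R (y - s)) (v y + v s)" if "y > 0" for y
    proof -
      have "inner (v y) (u s) = inner (u y) (v s)"
        using sym[OF uD(1) uD(1), of y s] uD(2) \<open>s > 0\<close> \<open>y > 0\<close> by simp
      then show ?thesis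
        by (simp add: inner_diff_left inner_diff_right inner_add_right inner_commute divide_inverse mult.commute)
    qed
    moreover have "\<forall>\<^sub>F y in at s. y > 0"
      using \<open>s > 0\<close> eventually_at_in_open'[of "{0<..}" s] by auto
    ultimately have "\<forall>\<^sub>F y in at s. inner ((u y - u s) /\<^sub>R (y - s)) (v y + v s) =
        (inner (v y) (u y) - inner (v s) (u s)) / (y - s)"
      by (auto elim!: eventually_mono)
    moreover have "((\<lambda>y. inner ((u y - u s) /\<^sub>R (y - s)) (v y + v s)) \<longlongrightarrow> - 2 * (norm (v s))\<^sup>2) (at s)"
      using tendsto_inner[OF uq[OF that] tendsto_add[OF cont(2)[OF that] tendsto_const[of "v s"]]]
      by (simp add: inner_add_right power2_norm_eq_inner)
    ultimately show "((\<lambda>y. (inner (v y) (u y) - inner (v s) (u s)) / (y - s)) \<longlongrightarrow> - 2 * (norm (v s))\<^sup>2) (at s)"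
      by (rule Lim_transform_eventually[rotated])
  qed
  have "F 0 \<ge> F t"
  \<comment> \<open>Derivatives are available for positive times only; the endpoint 0 is reached by
    continuity, and there the factor \<open>s\<close> removes the energy term. Inside, the
    derivative of this factor cancels the derivative of the squared norm.\<close>
  proof (rule DERIV_nonpos_imp_decreasing_open[OF \<open>t \<ge> 0\<close>])
    show "continuous_on {0..t} F"
      unfolding F_def[abs_def] u_def v_def by (intro continuous_intros orbit_cont)
    fix s :: real assume "0 < s" "s < t"
    have "(F has_real_derivative - 4 * s * (norm (v s))\<^sup>2) (at s)"
      unfolding F_def[abs_def]
      by (rule derivative_eq_intros n2 q \<open>0 < s\<close> refl)+ simp
    then show "\<exists>y. (F has_real_derivative y) (at s) \<and> y \<le> 0"
      using \<open>0 < s\<close> by (intro exI[of _ "- 4 * s * (norm (v s))\<^sup>2"]) simp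
  qed
  then show "2 * t * inner (L (T t f)) (T t f) + (norm (T t f))\<^sup>2 \<le> (norm f)\<^sup>2"
    using uD(2)[OF \<open>t \<ge> 0\<close>] T0 by (simp add: F_def u_def)
qed

section \<open>The form domain as a closed subspace\<close>

lemma infsum_ennreal_eq:
  assumes "f summable_on A" "\<And>x. f x \<ge> 0"
  shows "(\<Sum>\<^sub>\<infinity>x\<in>A. ennreal (f x)) = ennreal (\<Sum>\<^sub>\<infinity>x\<in>A. f x)"
  using infsum_nonneg_is_SUPREMUM_ennreal[OF assms] assms(2)
  by (simp add: nonneg_infsum_complete sum_ennreal)

lemma infsum_ennreal_finite_iff:
  assumes "\<And>x. f x \<ge> 0"
  shows "(\<Sum>\<^sub>\<infinity>x\<in>A. ennreal (f x)) < \<infinity> \<longleftrightarrow> f summable_on A"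
proof
  assume fin: "(\<Sum>\<^sub>\<infinity>x\<in>A. ennreal (f x)) < \<infinity>"
  have "sum f F \<le> enn2real (\<Sum>\<^sub>\<infinity>x\<in>A. ennreal (f x))" if "finite F" "F \<subseteq> A" for F
  proof -
    have "ennreal (sum f F) = (\<Sum>x\<in>F. ennreal (f x))"
      using assms by (simp add: sum_ennreal)
    also have "\<dots> \<le> (\<Sum>\<^sub>\<infinity>x\<in>A. ennreal (f x))"
      by (subst nonneg_infsum_complete) (use that in \<open>auto intro: SUP_upper\<close>)
    finally have "enn2real (ennreal (sum f F)) \<le> enn2real (\<Sum>\<^sub>\<infinity>x\<in>A. ennreal (f x))"
      using fin by (intro enn2real_mono) auto
    then show ?thesis
      using assms by (simp add: sum_nonneg)
  qed
  then show "f summable_on A"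
    using assms
    by (intro nonneg_bdd_above_summable_on bdd_aboveI2[of _ _ "enn2real (\<Sum>\<^sub>\<infinity>x\<in>A. ennreal (f x))"]) auto
qed (simp add: infsum_ennreal_eq assms)

section \<open>Weighted square summable functions inside the sequence space\<close>

lemma ell2_iff:
  assumes "\<And>x. w x \<ge> 0"
  shows "f \<in> ell2 w \<longleftrightarrow> (\<lambda>x. (sqrt (w x) * f x)\<^sup>2) summable_on UNIV"
  using assms by (simp add: ell2_def power_mult_distrib)

lemma ell2_lincomb:
  assumes "\<And>x. w x \<ge> 0" "f \<in> ell2 w" "g \<in> ell2 w"
  shows "(\<lambda>x. r * f x + s * g x) \<in> ell2 w"
proof -
  have "(\<lambda>x. (r * (sqrt (w x) * f x) + s * (sqrt (w x) * g x))\<^sup>2) summable_on UNIV"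
    using assms by (intro square_summable_add square_summable_scale) (simp_all add: ell2_iff)
  then show ?thesis
    using assms(1) by (simp add: ell2_iff algebra_simps)
qed

text \<open>Multiplication by \<open>sqrt w\<close> turns weighted into unweighted square summability; weights may
  vanish, as \<open>b\<close> and \<open>c\<close> do.\<close>

definition emb :: "('a \<Rightarrow> real) \<Rightarrow> ('a \<Rightarrow> real) \<Rightarrow> 'a l2seq" where
  "emb w f = l2seq (\<lambda>x. sqrt (w x) * f x)"

lemma coord_emb:
  assumes "\<And>x. w x \<ge> 0" "f \<in> ell2 w"
  shows "coord (emb w f) x = sqrt (w x) * f x"
  using assms ell2_iff[of w f] by (simp add: emb_def l2seq_inverse)

lemma emb_lincomb:
  assumes "\<And>x. w x \<ge> 0" "f \<in> ell2 w" "g \<in> ell2 w"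
  shows "emb w (\<lambda>x. r * f x + s * g x) = r *\<^sub>R emb w f + s *\<^sub>R emb w g"
  using assms by (intro l2seq_eqI) (simp add: coord_emb ell2_lincomb algebra_simps)

lemma inner_emb:
  assumes "\<And>x. w x \<ge> 0" "f \<in> ell2 w" "g \<in> ell2 w"
  shows "inner (emb w f) (emb w g) = l2_inner w f g"
proof -
  have "sqrt (w x) * f x * (sqrt (w x) * g x) = w x * f x * g x" for x
    using real_sqrt_mult_self[of "w x"] assms(1)[of x] by (simp add: mult_ac)
  then show ?thesis
    unfolding inner_l2seq_eq l2_inner_def using assms by (intro infsum_cong) (simp add: coord_emb)
qed

lemma norm_emb:
  assumes "\<And>x. w x \<ge> 0" "f \<in> ell2 w"
  shows "norm (emb w f) = l2_norm w f"
  using inner_emb[OF assms assms(2)] by (simp add: norm_l2seq_def l2_norm_def)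

text \<open>A two-sided inverse of \<open>emb w\<close> when \<open>w\<close> is positive
  everywhere. It is therefore used with \<open>m\<close>, while the components belonging to
  \<open>c\<close> and \<open>edge_weight b\<close> are compared by coordinates.\<close>

definition unemb :: "('a \<Rightarrow> real) \<Rightarrow> 'a l2seq \<Rightarrow> 'a \<Rightarrow> real" where
  "unemb w v = (\<lambda>x. coord v x / sqrt (w x))"

lemma unemb_in_ell2:
  assumes "\<And>x. w x > 0"
  shows "unemb w v \<in> ell2 w"
  using assms coord_summable[of v] by (simp add: ell2_iff less_imp_le unemb_def less_imp_neq[symmetric])

lemma emb_unemb:
  assumes "\<And>x. w x > 0"
  shows "emb w (unemb w v) = v"
  using assms unemb_in_ell2[OF assms, where v = v]
  by (intro l2seq_eqI) (simp add: coord_emb less_imp_le unemb_def less_imp_neq[symmetric])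

lemma unemb_emb:
  assumes "\<And>x. w x > 0" "f \<in> ell2 w"
  shows "unemb w (emb w f) = f"
  using assms by (simp add: unemb_def coord_emb less_imp_le less_imp_neq[symmetric])

lemma unemb_lincomb: "unemb w (r *\<^sub>R u + s *\<^sub>R v) = (\<lambda>x. r * unemb w u x + s * unemb w v x)"
  by (simp add: unemb_def add_divide_distrib)

lemma bounded_linear_unemb: "bounded_linear (\<lambda>v. unemb w v x)"
  unfolding unemb_def by (intro bounded_linear_compose[OF bounded_linear_divide] bounded_linear_coord)

lemma Cc_subset_ell2: "Cc \<subseteq> ell2 w"
proof
  fix f :: "'a \<Rightarrow> real" assume "f \<in> Cc"
  then have "finite {x. w x * (f x)\<^sup>2 \<noteq> 0}"
    unfolding Cc_def mem_Collect_eq by (rule rev_finite_subset) auto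
  then show "f \<in> ell2 w"
    by (simp add: ell2_def finite_nonzero_values_imp_summable_on)
qed

lemma Cc_lincomb:
  assumes "f \<in> Cc" "g \<in> Cc"
  shows "(\<lambda>x. r * f x + s * g x) \<in> Cc"
proof -
  have "{x. r * f x + s * g x \<noteq> 0} \<subseteq> {x. f x \<noteq> 0} \<union> {x. g x \<noteq> 0}" by auto
  then show ?thesis
    using assms by (auto simp: Cc_def intro: finite_subset)
qed

lemma subspace_closure:
  fixes S :: "'a :: real_normed_vector set"
  assumes "subspace S"
  shows "subspace (closure S)"
proof (rule subspaceI)
  show "0 \<in> closure S"
    using subspace_0[OF assms] closure_subset by blast
  show "x + y \<in> closure S" if x: "x \<in> closure S" and y: "y \<in> closure S" for x y
  proof -
    obtain u v where "\<forall>n. u n \<in> S" "u \<longlonglongrightarrow> x" "\<forall>n. v n \<in> S" "v \<longlonglongrightarrow> y"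
      using x y unfolding closure_sequential by blast
    then show ?thesis
      unfolding closure_sequential using subspace_add[OF assms]
      by (intro exI[of _ "\<lambda>n. u n + v n"]) (auto intro: tendsto_add)
  qed
  show "r *\<^sub>R x \<in> closure S" if x: "x \<in> closure S" for r x
  proof -
    obtain u where "\<forall>n. u n \<in> S" "u \<longlonglongrightarrow> x"
      using x unfolding closure_sequential by blast
    then show ?thesis
      unfolding closure_sequential using subspace_scale[OF assms]
      by (intro exI[of _ "\<lambda>n. r *\<^sub>R u n"]) (auto intro: tendsto_scaleR)
  qed
qed

text \<open>The factor \<open>1/2\<close> compensates for counting every edge in both directions.\<close>

definition edge_weight :: "('a \<Rightarrow> 'a \<Rightarrow> real) \<Rightarrow> 'a \<times> 'a \<Rightarrow> real" where
  "edge_weight b = (\<lambda>(x, y). b x y / 2)"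

definition grad :: "('a \<Rightarrow> real) \<Rightarrow> 'a \<times> 'a \<Rightarrow> real" where
  "grad f = (\<lambda>(x, y). f x - f y)"

lemma grad_lincomb: "grad (\<lambda>x. r * f x + s * g x) = (\<lambda>e. r * grad f e + s * grad g e)"
  by (auto simp: grad_def algebra_simps)

section \<open>The form norm of a graph with a measure\<close>

locale measured_graph =
  fixes b :: "'a \<Rightarrow> 'a \<Rightarrow> real" and c m :: "'a \<Rightarrow> real"
  assumes is_graph: "graph b c"
    and m_pos: "m x > 0"
begin

lemma weights_nonneg: "edge_weight b e \<ge> 0" "c x \<ge> 0" "m x \<ge> 0"
  using is_graph m_pos[of x] by (auto simp: graph_def edge_weight_def split: prod.split intro: less_imp_le)

lemma energy_eq:
  "energy b c f = (\<Sum>\<^sub>\<infinity>e. ennreal (edge_weight b e * (grad f e)\<^sup>2)) + (\<Sum>\<^sub>\<infinity>x. ennreal (c x * (f x)\<^sup>2))"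
proof -
  let ?g = "\<lambda>e. ennreal (edge_weight b e * (grad f e)\<^sup>2)"
  have "ennreal (b x y * (f x - f y)\<^sup>2) = ?g (x, y) + ?g (x, y)" for x y
    using weights_nonneg(1)[of "(x, y)"]
    by (simp add: edge_weight_def grad_def flip: ennreal_plus)
  then have "(\<Sum>\<^sub>\<infinity>(x, y)\<in>UNIV. ennreal (b x y * (f x - f y)\<^sup>2)) = (\<Sum>\<^sub>\<infinity>e. ?g e + ?g e)"
    by (intro infsum_cong) auto
  also have "\<dots> = infsum ?g UNIV * 2"
  proof -
    have "?g summable_on UNIV"
      by (rule nonneg_summable_on_complete) simp
    from infsum_add[OF this this] show ?thesis by (simp add: mult_2_right)
  qed
  finally show ?thesis
    by (simp add: energy_def ennreal_mult_divide_eq)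
qed

lemma finite_energy_iff: "f \<in> finite_energy b c \<longleftrightarrow> grad f \<in> ell2 (edge_weight b) \<and> f \<in> ell2 c"
proof -
  have "x + y < \<infinity> \<longleftrightarrow> x < \<infinity> \<and> y < \<infinity>" for x y :: ennreal
    by (simp add: ennreal_add_less_top)
  then show ?thesis
    unfolding finite_energy_def mem_Collect_eq energy_eq ell2_def
    using infsum_ennreal_finite_iff[of "\<lambda>e. edge_weight b e * (grad f e)\<^sup>2" UNIV]
      infsum_ennreal_finite_iff[of "\<lambda>x. c x * (f x)\<^sup>2" UNIV] weights_nonneg
    by simp
qed

lemma enn2real_energy:
  assumes "f \<in> finite_energy b c"
  shows "enn2real (energy b c f) = l2_inner (edge_weight b) (grad f) (grad f) + l2_inner c f f"
proof -
  have "(\<lambda>e. edge_weight b e * (grad f e)\<^sup>2) summable_on UNIV" "(\<lambda>x. c x * (f x)\<^sup>2) summable_on UNIV"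
    using assms by (simp_all add: finite_energy_iff ell2_def)
  then show ?thesis
    unfolding energy_eq l2_inner_def
    using weights_nonneg
    by (simp add: infsum_ennreal_eq infsum_nonneg power2_eq_square mult.assoc flip: ennreal_plus)
qed

lemma energy_form_eq:
  "energy_form b c f g = l2_inner (edge_weight b) (grad f) (grad g) + l2_inner c f g"
proof -
  have "(\<Sum>\<^sub>\<infinity>(x, y)\<in>UNIV. b x y * (f x - f y) * (g x - g y)) / 2 =
      (\<Sum>\<^sub>\<infinity>e. (1 / 2) * (case e of (x, y) \<Rightarrow> b x y * (f x - f y) * (g x - g y)))"
    by (subst infsum_cmult_right') simp
  also have "\<dots> = l2_inner (edge_weight b) (grad f) (grad g)"
    unfolding l2_inner_def by (rule infsum_cong) (auto simp: edge_weight_def grad_def)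
  finally show ?thesis
    by (simp add: energy_form_def l2_inner_def)
qed

definition form_space :: "('a \<Rightarrow> real) set" where
  "form_space = finite_energy b c \<inter> ell2 m"

lemma form_spaceD:
  assumes "f \<in> form_space"
  shows "grad f \<in> ell2 (edge_weight b)" "f \<in> ell2 c" "f \<in> ell2 m"
  using assms by (auto simp: form_space_def finite_energy_iff)

lemma form_space_lincomb:
  assumes "f \<in> form_space" "g \<in> form_space"
  shows "(\<lambda>x. r * f x + s * g x) \<in> form_space"
  using form_spaceD[OF assms(1)] form_spaceD[OF assms(2)] weights_nonneg
  by (simp add: form_space_def finite_energy_iff grad_lincomb ell2_lincomb)

text \<open>A linear isometry for the form norm. It turns approximation in that norm into closure in
  a complete product space.\<close>

definition form_emb :: "('a \<Rightarrow> real) \<Rightarrow> ('a \<times> 'a) l2seq \<times> 'a l2seq \<times> 'a l2seq" where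
  "form_emb f = (emb (edge_weight b) (grad f), emb c f, emb m f)"

lemma form_emb_lincomb:
  assumes "f \<in> form_space" "g \<in> form_space"
  shows "form_emb (\<lambda>x. r * f x + s * g x) = r *\<^sub>R form_emb f + s *\<^sub>R form_emb g"
  using form_spaceD[OF assms(1)] form_spaceD[OF assms(2)] weights_nonneg
  by (simp add: form_emb_def grad_lincomb emb_lincomb)

lemma norm_form_emb:
  assumes "f \<in> form_space"
  shows "(norm (form_emb f))\<^sup>2 = energy_form b c f f + (l2_norm m f)\<^sup>2"
    "dirichlet_norm b c m f = norm (form_emb f)"
proof -
  note f = form_spaceD[OF assms]
  have "(norm (form_emb f))\<^sup>2 = inner (form_emb f) (form_emb f)"
    by (rule power2_norm_eq_inner)
  also have "\<dots> = energy_form b c f f + (norm (emb m f))\<^sup>2"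
    using f weights_nonneg unfolding power2_norm_eq_inner
    by (simp add: form_emb_def inner_prod_def energy_form_eq inner_emb)
  finally show eq: "(norm (form_emb f))\<^sup>2 = energy_form b c f f + (l2_norm m f)\<^sup>2"
    using f weights_nonneg by (simp add: norm_emb)
  have "enn2real (energy b c f) = energy_form b c f f"
    using assms by (simp add: form_space_def enn2real_energy energy_form_eq)
  then show "dirichlet_norm b c m f = norm (form_emb f)"
    using eq by (simp add: dirichlet_norm_def flip: eq)
qed

text \<open>This is the closedness of the energy form. As \<open>m\<close> is positive, convergence
  of the third components forces pointwise convergence; the pointwise limit then identifies the
  coordinates of the other two limits, even where their weights vanish.\<close>

lemma form_emb_closed:
  assumes "\<And>n. g n \<in> form_space" "(\<lambda>n. form_emb (g n)) \<longlonglongrightarrow> k"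
  shows "unemb m (snd (snd k)) \<in> form_space" "form_emb (unemb m (snd (snd k))) = k"
proof -
  define f where "f = unemb m (snd (snd k))"
  obtain k1 k2 k3 where k: "k = (k1, k2, k3)" by (cases k)
  have lim: "(\<lambda>n. emb (edge_weight b) (grad (g n))) \<longlonglongrightarrow> k1" "(\<lambda>n. emb c (g n)) \<longlonglongrightarrow> k2"
    "(\<lambda>n. emb m (g n)) \<longlonglongrightarrow> k3"
    using tendsto_fst[OF assms(2)] tendsto_fst[OF tendsto_snd[OF assms(2)]]
      tendsto_snd[OF tendsto_snd[OF assms(2)]]
    by (simp_all add: form_emb_def k)
  note g = form_spaceD[OF assms(1)]
  have pointwise: "(\<lambda>n. g n x) \<longlonglongrightarrow> f x" for x
    using bounded_linear.tendsto[OF bounded_linear_unemb lim(3), of m x] g m_pos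
    by (simp add: unemb_emb f_def k)
  have coord1: "coord k1 e = sqrt (edge_weight b e) * grad f e" for e
  proof (rule LIMSEQ_unique)
    show "(\<lambda>n. coord (emb (edge_weight b) (grad (g n))) e) \<longlonglongrightarrow> coord k1 e"
      by (rule bounded_linear.tendsto[OF bounded_linear_coord lim(1)])
    have "(\<lambda>n. grad (g n) e) \<longlonglongrightarrow> grad f e"
      by (cases e) (auto simp: grad_def intro: tendsto_diff pointwise)
    then show "(\<lambda>n. coord (emb (edge_weight b) (grad (g n))) e) \<longlonglongrightarrow> sqrt (edge_weight b e) * grad f e"
      using g weights_nonneg by (simp add: coord_emb tendsto_mult_left)
  qed
  have coord2: "coord k2 x = sqrt (c x) * f x" for x
  proof (rule LIMSEQ_unique)
    show "(\<lambda>n. coord (emb c (g n)) x) \<longlonglongrightarrow> coord k2 x"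
      by (rule bounded_linear.tendsto[OF bounded_linear_coord lim(2)])
    show "(\<lambda>n. coord (emb c (g n)) x) \<longlonglongrightarrow> sqrt (c x) * f x"
      using g weights_nonneg pointwise by (simp add: coord_emb tendsto_mult_left)
  qed
  have "grad f \<in> ell2 (edge_weight b)" "f \<in> ell2 c"
    using weights_nonneg coord_summable[of k1] coord_summable[of k2]
    by (simp_all add: ell2_iff coord1 coord2)
  moreover have "f \<in> ell2 m" "emb m f = k3"
    using unemb_in_ell2[OF m_pos] emb_unemb[OF m_pos] by (simp_all add: f_def k)
  moreover have "emb (edge_weight b) (grad f) = k1" "emb c f = k2"
    using coord_emb[OF weights_nonneg(1) \<open>grad f \<in> _\<close>] coord_emb[OF weights_nonneg(2) \<open>f \<in> ell2 c\<close>]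
    by (auto intro!: l2seq_eqI simp only: coord1 coord2)
  ultimately show "unemb m (snd (snd k)) \<in> form_space" "form_emb (unemb m (snd (snd k))) = k"
    unfolding f_def[symmetric] by (simp_all add: form_space_def finite_energy_iff form_emb_def k)
qed

text \<open>From \<open>(f x - f y)\<^sup>2 \<le> 2 * ((f x)\<^sup>2 + (f y)\<^sup>2)\<close> and
  the symmetry of \<open>b\<close>, the edge energy is dominated by finitely many nonzero multiples
  of row sums of \<open>b\<close>, which are finite for a graph.\<close>

lemma Cc_subset_form_space: "Cc \<subseteq> form_space"
proof
  fix f :: "'a \<Rightarrow> real" assume f: "f \<in> Cc"
  have sum_b: "(\<lambda>y. b x y) summable_on UNIV" for x
    using is_graph unfolding graph_def by blast
  have "(\<lambda>(x, y). b x y * (f x)\<^sup>2) summable_on (UNIV \<times> UNIV)"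
  proof (rule summable_on_SigmaI)
    show "((\<lambda>y. case (x, y) of (x, y) \<Rightarrow> b x y * (f x)\<^sup>2) has_sum (\<Sum>\<^sub>\<infinity>y. b x y) * (f x)\<^sup>2) UNIV" for x
      using has_sum_cmult_left[OF has_sum_infsum[OF sum_b]] by simp
    \<comment> \<open>Here the row sums of \<open>b\<close> take the role of the weight.\<close>
    show "(\<lambda>x. (\<Sum>\<^sub>\<infinity>y. b x y) * (f x)\<^sup>2) summable_on UNIV"
      using Cc_subset_ell2[of "\<lambda>x. \<Sum>\<^sub>\<infinity>y. b x y"] f by (auto simp: ell2_def)
  qed (use is_graph in \<open>auto simp: graph_def\<close>)
  then have s1: "(\<lambda>(x, y). b x y * (f x)\<^sup>2) summable_on UNIV" by simp
  then have s2: "(\<lambda>(x, y). b x y * (f y)\<^sup>2) summable_on UNIV"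
    using summable_on_swap[of "\<lambda>(x, y). b x y * (f x)\<^sup>2" UNIV UNIV] is_graph
    by (simp add: graph_def case_prod_unfold)
  have "(\<lambda>e. edge_weight b e * (grad f e)\<^sup>2) summable_on UNIV"
  proof (rule summable_on_comparison_test[OF summable_on_add[OF s1 s2]])
    fix e :: "'a \<times> 'a"
    obtain x y where e: "e = (x, y)" by (cases e)
    have "(f x - f y)\<^sup>2 \<le> 2 * ((f x)\<^sup>2 + (f y)\<^sup>2)"
      using zero_le_power2[of "f x + f y"] by (simp add: power2_sum power2_diff)
    then have "b x y / 2 * (f x - f y)\<^sup>2 \<le> b x y / 2 * (2 * ((f x)\<^sup>2 + (f y)\<^sup>2))"
      using is_graph by (intro mult_left_mono) (auto simp: graph_def)
    then show "edge_weight b e * (grad f e)\<^sup>2 \<le>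
        (case e of (x, y) \<Rightarrow> b x y * (f x)\<^sup>2) + (case e of (x, y) \<Rightarrow> b x y * (f y)\<^sup>2)"
      by (simp add: e edge_weight_def grad_def algebra_simps)
  qed (use weights_nonneg in simp)
  then show "f \<in> form_space"
    using f Cc_subset_ell2 by (auto simp: form_space_def finite_energy_iff ell2_def)
qed

lemma dirichlet_domain_eq:
  "dirichlet_domain b c m = {f \<in> form_space. form_emb f \<in> closure (form_emb ` Cc)}"
proof -
  have "dirichlet_norm b c m (\<lambda>x. f x - g x) = dist (form_emb g) (form_emb f)"
    if "f \<in> form_space" "g \<in> Cc" for f g
  proof -
    have g: "g \<in> form_space" using that(2) Cc_subset_form_space by blast
    show ?thesis
      using norm_form_emb(2)[OF form_space_lincomb[OF that(1) g, of 1 "-1"]]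
        form_emb_lincomb[OF that(1) g, of 1 "-1"]
      by (simp add: dist_norm norm_minus_commute)
  qed
  then show ?thesis
    unfolding dirichlet_domain_def form_space_def[symmetric] closure_approachable bex_simps(7)
    by (auto simp: image_iff)
qed

text \<open>Together with \<open>dirichlet_domain_eq\<close> this makes the image of the form domain
  the whole closure, hence complete; taking the closure adds no ideal elements.\<close>

lemma closure_form_emb_Cc:
  assumes "k \<in> closure (form_emb ` Cc)"
  shows "unemb m (snd (snd k)) \<in> dirichlet_domain b c m" "form_emb (unemb m (snd (snd k))) = k"
proof -
  obtain s where s: "\<And>n. s n \<in> form_emb ` Cc" "s \<longlonglongrightarrow> k"
    using assms unfolding closure_sequential by blast
  then have "\<forall>n. \<exists>g. g \<in> Cc \<and> s n = form_emb g" by blast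
  then obtain g where g: "\<And>n. g n \<in> Cc" "\<And>n. s n = form_emb (g n)"
    unfolding choice_iff by blast
  have "s = (\<lambda>n. form_emb (g n))"
    using g(2) by (rule ext)
  with s(2) have "(\<lambda>n. form_emb (g n)) \<longlonglongrightarrow> k" by (simp only:)
  then have "unemb m (snd (snd k)) \<in> form_space" "form_emb (unemb m (snd (snd k))) = k"
    using form_emb_closed[of g k] g(1) Cc_subset_form_space by blast+
  then show "unemb m (snd (snd k)) \<in> dirichlet_domain b c m" "form_emb (unemb m (snd (snd k))) = k"
    using assms by (simp_all add: dirichlet_domain_eq)
qed

lemma dirichlet_domain_subset_finite_energy0: "dirichlet_domain b c m \<subseteq> finite_energy0 b c p"
proof
  fix f assume f: "f \<in> dirichlet_domain b c m"
  have "\<exists>g\<in>Cc. pointed_norm b c p (\<lambda>x. f x - g x) < e" if "e > 0" for e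
  proof -
    \<comment> \<open>A single atom of the measure gives
      \<open>(h p)\<^sup>2 \<le> (l2_norm m h)\<^sup>2 / m p\<close>, so \<open>M\<close> bounds the
      ratio of the squared pointed norm to the squared form norm.\<close>
    define M where "M = 1 + 1 / m p"
    have "M \<ge> 1" using m_pos[of p] by (simp add: M_def)
    then have "e / sqrt M > 0" using \<open>e > 0\<close> by simp
    then obtain g where g: "g \<in> Cc" "dirichlet_norm b c m (\<lambda>x. f x - g x) < e / sqrt M"
      using f unfolding dirichlet_domain_def by blast
    define h where "h = (\<lambda>x. f x - g x)"
    have h: "h \<in> form_space"
      using form_space_lincomb[of f g 1 "-1"] f subsetD[OF Cc_subset_form_space g(1)]
      by (simp add: h_def dirichlet_domain_eq)
    have "\<bar>sqrt (m p) * h p\<bar> \<le> l2_norm m h"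
      using abs_coord_le[of "emb m h" p] form_spaceD(3)[OF h] weights_nonneg
      by (simp add: coord_emb norm_emb)
    from power_mono[OF this, of 2] have "m p * (h p)\<^sup>2 \<le> (l2_norm m h)\<^sup>2"
      using weights_nonneg by (simp add: power_mult_distrib)
    then have "(h p)\<^sup>2 \<le> (l2_norm m h)\<^sup>2 / m p"
      using m_pos[of p] by (simp add: field_simps)
    moreover have energy: "enn2real (energy b c h) = energy_form b c h h"
      using h by (simp add: enn2real_energy energy_form_eq form_space_def)
    moreover have "energy_form b c h h \<ge> 0"
      using enn2real_nonneg[of "energy b c h"] by (simp only: energy)
    ultimately have "energy_form b c h h + (h p)\<^sup>2 \<le> M * (energy_form b c h h + (l2_norm m h)\<^sup>2)"
    proof -
      assume *: "(h p)\<^sup>2 \<le> (l2_norm m h)\<^sup>2 / m p" "energy_form b c h h \<ge> 0"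
      have "energy_form b c h h / m p \<ge> 0"
        using *(2) m_pos[of p] by simp
      moreover have "M * (energy_form b c h h + (l2_norm m h)\<^sup>2) = energy_form b c h h + (l2_norm m h)\<^sup>2
          + energy_form b c h h / m p + (l2_norm m h)\<^sup>2 / m p"
        by (simp add: M_def distrib_right add_divide_distrib)
      ultimately show ?thesis
        using *(1) zero_le_power2[of "l2_norm m h"] by linarith
    qed
    then have "pointed_norm b c p h \<le> sqrt M * dirichlet_norm b c m h"
      by (simp add: pointed_norm_def dirichlet_norm_def energy flip: real_sqrt_mult)
    also have "\<dots> < e"
      using g(2) \<open>M \<ge> 1\<close> by (simp add: h_def pos_less_divide_eq mult.commute)
    finally show ?thesis using g(1) h_def by blast
  qed
  then show "f \<in> finite_energy0 b c p"
    using f by (auto simp: finite_energy0_def dirichlet_domain_eq form_space_def)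
qed

text \<open>The family is indexed by the vertices: evaluation at \<open>x\<close> acts through the
  third component and is a bounded functional on the whole product space. The family is pointwise
  bounded on the closure of the embedded finitely supported functions, which is why uniform
  boundedness is formulated relative to a complete subspace.\<close>

lemma sup_bound:
  assumes "uniformly_transient b c"
  shows "\<exists>C>0. \<forall>f\<in>dirichlet_domain b c m. \<forall>x. \<bar>f x\<bar> \<le> C * norm (form_emb f)"
proof -
  let ?S = "closure (form_emb ` Cc)"
  obtain p where p: "finite_energy0 b c p \<subseteq> C0"
    using assms by (auto simp: uniformly_transient_def)
  have Cc_sub: "subspace (form_emb ` Cc)"
  proof (rule subspaceI)
    have "(\<lambda>x. 0) \<in> form_space" "(\<lambda>x. 0) \<in> Cc"
      using Cc_subset_form_space by (auto simp: Cc_def)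
    then show "0 \<in> form_emb ` Cc"
      using form_emb_lincomb[of "\<lambda>x. 0" "\<lambda>x. 0" 0 0] by (auto simp: image_iff)
    show "u + v \<in> form_emb ` Cc" if uv: "u \<in> form_emb ` Cc" "v \<in> form_emb ` Cc" for u v
    proof -
      obtain f g where fg: "f \<in> Cc" "g \<in> Cc" "u = form_emb f" "v = form_emb g"
        using uv by blast
      then have "u + v = form_emb (\<lambda>x. 1 * f x + 1 * g x)"
        using form_emb_lincomb[of f g 1 1] subsetD[OF Cc_subset_form_space] by simp
      then show ?thesis using Cc_lincomb[OF fg(1,2)] by blast
    qed
    show "r *\<^sub>R u \<in> form_emb ` Cc" if u: "u \<in> form_emb ` Cc" for r u
    proof -
      obtain f where f: "f \<in> Cc" "u = form_emb f"
        using u by blast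
      then have "r *\<^sub>R u = form_emb (\<lambda>x. r * f x + 0 * f x)"
        using form_emb_lincomb[of f f r 0] subsetD[OF Cc_subset_form_space] by simp
      then show ?thesis using Cc_lincomb[OF f(1) f(1)] by blast
    qed
  qed
  have "\<exists>C>0. \<forall>x. \<forall>k\<in>?S. norm (unemb m (snd (snd k)) x) \<le> C * norm k"
  proof (rule uniform_boundedness_on_subspace)
    show "complete ?S" by (simp add: complete_eq_closed)
    show "subspace ?S" by (rule subspace_closure[OF Cc_sub])
    show "bounded_linear (\<lambda>k. unemb m (snd (snd k)) x)" for x
      by (intro bounded_linear_compose[OF bounded_linear_unemb] bounded_linear_compose[OF bounded_linear_snd]
          bounded_linear_snd)
    fix k assume "k \<in> ?S"
    then have "unemb m (snd (snd k)) \<in> ell_inf"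
      using closure_form_emb_Cc(1) dirichlet_domain_subset_finite_energy0 p unfolding C0_def by blast
    then show "bounded (range (\<lambda>x. unemb m (snd (snd k)) x))"
      by (simp add: ell_inf_def)
  qed
  then obtain C where C: "C > 0" "\<And>x k. k \<in> ?S \<Longrightarrow> \<bar>unemb m (snd (snd k)) x\<bar> \<le> C * norm k"
    by auto
  have "\<bar>f x\<bar> \<le> C * norm (form_emb f)" if "f \<in> dirichlet_domain b c m" for f x
    using C(2)[of "form_emb f" x] that m_pos
    by (simp add: dirichlet_domain_eq form_emb_def unemb_emb form_space_def)
  then show ?thesis using C(1) by blast
qed

end

section \<open>Ultracontractivity\<close>

lemma ultracontractiveI:
  assumes "linear_on_space (ell2 m) A"
    and "\<And>f x. f \<in> ell2 m \<Longrightarrow> \<bar>A f x\<bar> \<le> K * l2_norm m f"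
  shows "ultracontractive m A"
proof -
  have "A f \<in> ell_inf \<and> sup_norm (A f) \<le> K * l2_norm m f" if "f \<in> ell2 m" for f
    using assms(2)[OF that] by (auto simp: ell_inf_def bounded_iff sup_norm_def intro!: cSUP_least)
  then show ?thesis
    using assms(1) by (auto simp: ultracontractive_def bounded_operator_def)
qed

locale transient_dirichlet_operator = measured_graph b c m
  for b :: "'a \<Rightarrow> 'a \<Rightarrow> real" and c m :: "'a \<Rightarrow> real" +
  fixes D :: "('a \<Rightarrow> real) set" and L :: "('a \<Rightarrow> real) \<Rightarrow> 'a \<Rightarrow> real"
  assumes transient: "uniformly_transient b c"
    and operator: "dirichlet_operator b c m D L"
begin

lemma domainD:
  assumes "f \<in> D"
  shows "f \<in> dirichlet_domain b c m" "f \<in> ell2 m" "L f \<in> ell2 m"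
  using assms operator unfolding dirichlet_operator_def selfadjoint_operator_def by blast+

lemma operator_linear: "linear_on_space D L"
  using operator by (simp add: dirichlet_operator_def selfadjoint_operator_def)

lemma form_nonneg:
  assumes "f \<in> D"
  shows "l2_inner m (L f) f \<ge> 0" "(norm (form_emb f))\<^sup>2 = l2_inner m (L f) f + (l2_norm m f)\<^sup>2"
proof -
  have f: "f \<in> form_space" using domainD(1)[OF assms] by (simp add: dirichlet_domain_eq)
  have eq: "l2_inner m (L f) f = energy_form b c f f"
    using operator assms domainD(1)[OF assms] by (simp add: dirichlet_operator_def)
  also have "\<dots> = enn2real (energy b c f)"
    using f by (simp add: enn2real_energy energy_form_eq form_space_def)
  finally show "l2_inner m (L f) f \<ge> 0" by simp
  show "(norm (form_emb f))\<^sup>2 = l2_inner m (L f) f + (l2_norm m f)\<^sup>2"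
    using norm_form_emb(1)[OF f] eq by simp
qed

section \<open>The operator transported to the sequence space\<close>

definition seq_dom :: "'a l2seq set" where "seq_dom = {v. unemb m v \<in> D}"

text \<open>Since \<open>m\<close> is positive, \<open>unemb m\<close> maps the sequence space
  isometrically onto \<open>ell2 m\<close>. Conjugation by it makes \<open>L\<close> an operator on
  a complete inner product type, as the abstract lemmas require.\<close>

definition seq_op :: "'a l2seq \<Rightarrow> 'a l2seq" where "seq_op v = emb m (L (unemb m v))"

lemmas emb_unemb_m [simp] = emb_unemb[where w = m, OF m_pos]
lemmas unemb_emb_m = unemb_emb[where w = m, OF m_pos]
lemmas unemb_in_ell2_m [simp] = unemb_in_ell2[where w = m, OF m_pos]

lemma emb_in_dom:
  assumes "f \<in> D"
  shows "emb m f \<in> seq_dom" "seq_op (emb m f) = emb m (L f)"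
  using assms domainD[OF assms] by (simp_all add: seq_dom_def seq_op_def unemb_emb_m)

lemma unemb_op: "v \<in> seq_dom \<Longrightarrow> unemb m (seq_op v) = L (unemb m v)"
  using domainD(3) by (simp add: seq_dom_def seq_op_def unemb_emb_m)

lemma inner_eq_l2_inner: "inner u v = l2_inner m (unemb m u) (unemb m v)"
  using inner_emb[where w = m and f = "unemb m u" and g = "unemb m v", OF weights_nonneg(3)] by simp

lemma norm_eq_l2_norm: "norm v = l2_norm m (unemb m v)"
  using norm_emb[where w = m and f = "unemb m v", OF weights_nonneg(3)] by simp

lemma op_lincomb:
  assumes "u \<in> seq_dom" "v \<in> seq_dom"
  shows "r *\<^sub>R u + s *\<^sub>R v \<in> seq_dom \<and> seq_op (r *\<^sub>R u + s *\<^sub>R v) = r *\<^sub>R seq_op u + s *\<^sub>R seq_op v"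
  using assms operator_linear domainD(3) weights_nonneg(3)
  by (simp add: seq_dom_def seq_op_def unemb_lincomb linear_on_space_def emb_lincomb)

text \<open>The equality of \<open>adjoint_graph\<close> with the graph of \<open>L\<close>, in the
  shape of the hypothesis \<open>adj\<close> of \<open>shifted_selfadjoint_surj\<close>.\<close>

lemma op_adjoint: "(\<forall>v\<in>seq_dom. inner u (seq_op v) = inner h v) \<longleftrightarrow> u \<in> seq_dom \<and> h = seq_op u"
proof -
  have "(\<forall>v\<in>seq_dom. inner u (seq_op v) = inner h v) \<longleftrightarrow>
      (\<forall>g\<in>D. l2_inner m (unemb m u) (L g) = l2_inner m (unemb m h) g)"
  proof (intro iffI ballI)
    fix g assume *: "\<forall>v\<in>seq_dom. inner u (seq_op v) = inner h v" and "g \<in> D"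
    then show "l2_inner m (unemb m u) (L g) = l2_inner m (unemb m h) g"
      using emb_in_dom[OF \<open>g \<in> D\<close>] domainD[OF \<open>g \<in> D\<close>]
      by (auto simp: inner_eq_l2_inner unemb_emb_m dest!: bspec)
  next
    fix v assume "\<forall>g\<in>D. l2_inner m (unemb m u) (L g) = l2_inner m (unemb m h) g" and "v \<in> seq_dom"
    then show "inner u (seq_op v) = inner h v"
      by (simp add: inner_eq_l2_inner unemb_op) (simp add: seq_dom_def)
  qed
  also have "\<dots> \<longleftrightarrow> (unemb m u, unemb m h) \<in> adjoint_graph m D L"
    by (simp add: adjoint_graph_def)
  also have "\<dots> \<longleftrightarrow> u \<in> seq_dom \<and> unemb m h = L (unemb m u)"
    using operator by (auto simp: dirichlet_operator_def selfadjoint_operator_def seq_dom_def)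
  also have "\<dots> \<longleftrightarrow> u \<in> seq_dom \<and> h = seq_op u"
    using unemb_op seq_op_def by (metis emb_unemb_m)
  finally show ?thesis .
qed

lemma op_nonneg: "v \<in> seq_dom \<Longrightarrow> inner (seq_op v) v \<ge> 0"
  using form_nonneg(1) by (simp add: inner_eq_l2_inner unemb_op) (simp add: seq_dom_def)

lemma seq_dom_dense: "closure seq_dom = UNIV"
proof -
  have "\<exists>w\<in>seq_dom. dist w v < e" if "e > 0" for v e
  proof -
    obtain g where g: "g \<in> D" "l2_norm m (\<lambda>x. unemb m v x - g x) < e"
      using operator \<open>e > 0\<close> unemb_in_ell2_m[where v = v]
      unfolding dirichlet_operator_def selfadjoint_operator_def by blast
    have "norm (v - emb m g) = l2_norm m (\<lambda>x. unemb m v x - g x)"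
      using unemb_lincomb[of m 1 v "-1" "emb m g"] domainD(2)[OF g(1)]
      by (simp add: norm_eq_l2_norm unemb_emb_m)
    then show ?thesis
      using g emb_in_dom(1)[OF g(1)] by (intro bexI[of _ "emb m g"]) (simp_all add: dist_norm norm_minus_commute)
  qed
  then show ?thesis by (auto simp: closure_approachable)
qed

text \<open>On the operator domain the squared form norm equals
  \<open>inner (seq_op v) v + (norm v)\<^sup>2\<close>. From here on the graph enters through this
  inequality alone, and the resolvent and the semigroup only have to control these two
  terms.\<close>

lemma pointwise_bound:
  "\<exists>C>0. \<forall>v\<in>seq_dom. \<forall>x. \<bar>unemb m v x\<bar> \<le> C * sqrt (inner (seq_op v) v + (norm v)\<^sup>2)"
proof -
  obtain C where C: "C > 0" "\<And>f x. f \<in> dirichlet_domain b c m \<Longrightarrow> \<bar>f x\<bar> \<le> C * norm (form_emb f)"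
    using sup_bound[OF transient] by blast
  have "\<bar>unemb m v x\<bar> \<le> C * sqrt (inner (seq_op v) v + (norm v)\<^sup>2)" if "v \<in> seq_dom" for v x
  proof -
    have v: "unemb m v \<in> D" using that by (simp add: seq_dom_def)
    have "norm (form_emb (unemb m v)) = sqrt (inner (seq_op v) v + (norm v)\<^sup>2)"
      using form_nonneg(2)[OF v] that
      by (simp add: inner_eq_l2_inner norm_eq_l2_norm unemb_op real_sqrt_unique)
    then show ?thesis
      using C(2)[OF domainD(1)[OF v], of x] by simp
  qed
  then show ?thesis using C(1) by blast
qed

text \<open>Pairing \<open>h = seq_op v + \<alpha> *\<^sub>R v\<close> with \<open>v\<close> gives
  \<open>inner (seq_op v) v + \<alpha> * (norm v)\<^sup>2 \<le> norm h * norm v\<close>. Hence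
  \<open>norm v\<close> is at most \<open>norm h / \<alpha>\<close>, which yields
  \<open>1 / \<alpha>\<close> for the energy and \<open>1 / \<alpha>\<^sup>2\<close> for the squared
  norm.\<close>

lemma op_shift_bound:
  assumes "v \<in> seq_dom" "\<alpha> > 0"
  shows "\<alpha> * norm v \<le> norm (seq_op v + \<alpha> *\<^sub>R v)"
    and "inner (seq_op v) v + (norm v)\<^sup>2 \<le> (1 / \<alpha> + 1 / \<alpha>\<^sup>2) * (norm (seq_op v + \<alpha> *\<^sub>R v))\<^sup>2"
proof -
  let ?h = "seq_op v + \<alpha> *\<^sub>R v"
  have eq: "inner ?h v = inner (seq_op v) v + \<alpha> * norm v * norm v"
    by (simp add: inner_add_left power2_norm_eq_inner[symmetric] power2_eq_square)
  have cs: "inner ?h v \<le> norm ?h * norm v" by (rule norm_cauchy_schwarz)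
  have "\<alpha> * norm v * norm v \<le> norm ?h * norm v"
    using eq cs op_nonneg[OF assms(1)] by linarith
  then show le: "\<alpha> * norm v \<le> norm ?h"
    by (cases "v = 0") auto
  then have nv: "norm v \<le> norm ?h / \<alpha>"
    using \<open>\<alpha> > 0\<close> by (simp add: field_simps)
  have "inner (seq_op v) v \<le> norm ?h * norm v"
    using eq cs \<open>\<alpha> > 0\<close> by (smt (verit) mult_nonneg_nonneg norm_ge_zero)
  also have "\<dots> \<le> norm ?h * (norm ?h / \<alpha>)"
    using nv by (rule mult_left_mono) simp
  finally have "inner (seq_op v) v \<le> 1 / \<alpha> * (norm ?h)\<^sup>2"
    by (simp add: power2_eq_square)
  moreover have "(norm v)\<^sup>2 \<le> 1 / \<alpha>\<^sup>2 * (norm ?h)\<^sup>2"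
    using power_mono[OF nv, of 2] by (simp add: power_divide)
  ultimately show "inner (seq_op v) v + (norm v)\<^sup>2 \<le> (1 / \<alpha> + 1 / \<alpha>\<^sup>2) * (norm ?h)\<^sup>2"
    by (simp only: distrib_right add_mono)
qed

lemma unemb_shift:
  assumes "v \<in> seq_dom"
  shows "unemb m (seq_op v + \<alpha> *\<^sub>R v) = shifted_operator L \<alpha> (unemb m v)"
  using unemb_lincomb[of m 1 "seq_op v" \<alpha> v] unemb_op[OF assms] by (simp add: shifted_operator_def)

lemma shifted_emb:
  assumes "f \<in> D"
  shows "shifted_operator L \<alpha> f = unemb m (seq_op (emb m f) + \<alpha> *\<^sub>R emb m f)"
  using unemb_shift[OF emb_in_dom(1)[OF assms]] domainD(2)[OF assms] by (simp add: unemb_emb_m)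

text \<open>Injectivity is the lower bound of \<open>op_shift_bound\<close>; surjectivity is where
  selfadjointness, rather than mere symmetry, enters.\<close>

lemma shifted_bij:
  assumes "\<alpha> > 0"
  shows "bij_betw (shifted_operator L \<alpha>) D (ell2 m)"
  unfolding bij_betw_def
proof
  show "inj_on (shifted_operator L \<alpha>) D"
  proof (rule inj_onI)
    fix f g assume fg: "f \<in> D" "g \<in> D" "shifted_operator L \<alpha> f = shifted_operator L \<alpha> g"
    let ?u = "emb m f" and ?v = "emb m g"
    have "seq_op ?u + \<alpha> *\<^sub>R ?u = seq_op ?v + \<alpha> *\<^sub>R ?v"
      using fg shifted_emb emb_unemb_m by metis
    moreover have "?u - ?v \<in> seq_dom" "seq_op (?u - ?v) = seq_op ?u - seq_op ?v"
      using op_lincomb[OF emb_in_dom(1)[OF fg(1)] emb_in_dom(1)[OF fg(2)], of 1 "-1"] by auto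
    ultimately have "seq_op (?u - ?v) + \<alpha> *\<^sub>R (?u - ?v) = 0"
      by (simp add: scaleR_diff_right diff_add_eq add_diff_eq diff_diff_eq)
    then have "\<alpha> * norm (?u - ?v) \<le> 0"
      using op_shift_bound(1)[OF \<open>?u - ?v \<in> seq_dom\<close> assms] by simp
    then have "?u = ?v"
      using assms by (simp add: mult_le_0_iff)
    then show "f = g"
      using domainD(2) fg(1,2) unemb_emb_m by metis
  qed
  show "shifted_operator L \<alpha> ` D = ell2 m"
  proof (intro equalityI subsetI)
    fix h assume "h \<in> shifted_operator L \<alpha> ` D"
    then show "h \<in> ell2 m" using shifted_emb by auto
  next
    fix h assume h: "h \<in> ell2 m"
    obtain v where v: "v \<in> seq_dom" "seq_op v + \<alpha> *\<^sub>R v = emb m h"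
      using shifted_selfadjoint_surj[of seq_dom seq_op \<alpha> "emb m h"] op_lincomb op_adjoint op_nonneg assms
      by blast
    then have "h = shifted_operator L \<alpha> (unemb m v)"
      using unemb_shift[OF v(1), of \<alpha>] h by (simp add: unemb_emb_m)
    then show "h \<in> shifted_operator L \<alpha> ` D"
      using v(1) by (auto simp: seq_dom_def)
  qed
qed

section \<open>Bounds for the resolvent and the semigroup\<close>

lemma resolvent_ultracontractive:
  assumes "\<alpha> > 0"
  shows "ultracontractive m (resolvent D L \<alpha>)"
proof -
  note bij = shifted_bij[OF assms, unfolded bij_betw_def]
  have R: "resolvent D L \<alpha> h \<in> D" "shifted_operator L \<alpha> (resolvent D L \<alpha> h) = h" if "h \<in> ell2 m" for h
    using bij that the_inv_into_into[of "shifted_operator L \<alpha>" D h D]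
      f_the_inv_into_f[of "shifted_operator L \<alpha>" D h]
    by (simp_all add: resolvent_def)
  have lin: "linear_on_space (ell2 m) (resolvent D L \<alpha>)"
    unfolding linear_on_space_def
  proof (intro ballI allI conjI)
    fix f g :: "'a \<Rightarrow> real" and r s assume fg: "f \<in> ell2 m" "g \<in> ell2 m"
    show "(\<lambda>x. r * f x + s * g x) \<in> ell2 m"
      using fg weights_nonneg(3) by (intro ell2_lincomb)
    let ?R = "resolvent D L \<alpha>"
    have "(\<lambda>x. r * ?R f x + s * ?R g x) \<in> D"
      and "L (\<lambda>x. r * ?R f x + s * ?R g x) = (\<lambda>x. r * L (?R f) x + s * L (?R g) x)"
      using operator_linear R(1) fg by (auto simp: linear_on_space_def)
    moreover have "r * f x + s * g x = r * L (?R f) x + s * L (?R g) x + \<alpha> * (r * ?R f x + s * ?R g x)" for x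
    proof -
      have f: "f x = L (?R f) x + \<alpha> * ?R f x" and g: "g x = L (?R g) x + \<alpha> * ?R g x"
        using fun_cong[OF R(2)[OF fg(1)], of x] fun_cong[OF R(2)[OF fg(2)], of x]
        by (simp_all only: shifted_operator_def)
      show ?thesis
        by (subst f, subst g) (simp add: distrib_left mult.left_commute)
    qed
    \<comment> \<open>Linearity of the inverse by uniqueness: the combination of the two preimages
      lies in \<open>D\<close> and is mapped to the combination of \<open>f\<close> and
      \<open>g\<close>.\<close>
    ultimately show "?R (\<lambda>x. r * f x + s * g x) = (\<lambda>x. r * ?R f x + s * ?R g x)"
      unfolding resolvent_def using bij
      by (intro the_inv_into_f_eq) (auto simp: shifted_operator_def resolvent_def[symmetric])
  qed
  obtain C where C: "C > 0"
    "\<And>v x. v \<in> seq_dom \<Longrightarrow> \<bar>unemb m v x\<bar> \<le> C * sqrt (inner (seq_op v) v + (norm v)\<^sup>2)"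
    using pointwise_bound by blast
  show ?thesis
  proof (rule ultracontractiveI[OF lin])
    fix h x assume h: "h \<in> ell2 m"
    let ?v = "emb m (resolvent D L \<alpha> h)"
    have v: "?v \<in> seq_dom" "unemb m ?v = resolvent D L \<alpha> h"
      using R(1)[OF h] emb_in_dom(1) domainD(2) by (auto simp: unemb_emb_m)
    have "seq_op ?v + \<alpha> *\<^sub>R ?v = emb m h"
      using shifted_emb[OF R(1)[OF h], of \<alpha>] R(2)[OF h] emb_unemb_m by metis
    then have "sqrt (inner (seq_op ?v) ?v + (norm ?v)\<^sup>2) \<le> sqrt ((1 / \<alpha> + 1 / \<alpha>\<^sup>2) * (l2_norm m h)\<^sup>2)"
      using op_shift_bound(2)[OF v(1) assms] norm_emb[where w = m, OF weights_nonneg(3) h] by simp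
    then have "C * sqrt (inner (seq_op ?v) ?v + (norm ?v)\<^sup>2) \<le> C * (sqrt (1 / \<alpha> + 1 / \<alpha>\<^sup>2) * l2_norm m h)"
      using C(1) norm_emb[where w = m, OF weights_nonneg(3) h] norm_ge_zero[of "emb m h"]
      by (intro mult_left_mono) (simp_all add: real_sqrt_mult)
    then show "\<bar>resolvent D L \<alpha> h x\<bar> \<le> C * sqrt (1 / \<alpha> + 1 / \<alpha>\<^sup>2) * l2_norm m h"
      using C(2)[OF v(1), of x] v(2) by simp
  qed
qed

text \<open>For initial values in \<open>D\<close>, orbit decay bounds the form norm at time
  \<open>t\<close> and so every point value. For other initial values the point value itself is
  extended by continuity, so \<open>T t f\<close> need not be located in the form domain.\<close>

lemma semigroup_ultracontractive:
  assumes T: "exp_semigroup m D L T" and "t > 0"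
  shows "ultracontractive m (T t)"
proof -
  define S where "S s v = emb m (T s (unemb m v))" for s v
  have c0: "c0_semigroup m T" and gen: "generator_graph m T = {(f, \<lambda>x. - L f x) | f. f \<in> D}"
    using T by (simp_all add: exp_semigroup_def)
  have bdd_op: "bounded_operator (ell2 m) (l2_norm m) (ell2 m) (l2_norm m) (T s)" if "s \<ge> 0" for s
    using c0 that by (simp add: c0_semigroup_def)
  have T_in: "T s f \<in> ell2 m" if "s \<ge> 0" "f \<in> ell2 m" for s f
    using bdd_op[OF that(1)] that(2) unfolding bounded_operator_def by blast
  have T_lin: "linear_on_space (ell2 m) (T s)" if "s \<ge> 0" for s
    using bdd_op[OF that] by (simp add: bounded_operator_def)
  have unemb_S: "unemb m (S s v) = T s (unemb m v)" if "s \<ge> 0" for s v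
    using T_in[OF that] by (simp add: S_def unemb_emb_m)
  have diff: "norm (u - v) = l2_norm m (\<lambda>x. unemb m u x - unemb m v x)" for u v
    using unemb_lincomb[of m 1 u "-1" v] by (simp add: norm_eq_l2_norm)
  have S_bl: "bounded_linear (S s)" if "s \<ge> 0" for s
  proof -
    obtain K where K: "\<And>f. f \<in> ell2 m \<Longrightarrow> l2_norm m (T s f) \<le> K * l2_norm m f"
      using bdd_op[OF \<open>s \<ge> 0\<close>] unfolding bounded_operator_def by blast
    have lin: "S s (p *\<^sub>R u + q *\<^sub>R v) = p *\<^sub>R S s u + q *\<^sub>R S s v" for p q u v
      using T_lin[OF that] T_in[OF that] weights_nonneg(3)
      by (simp add: S_def unemb_lincomb linear_on_space_def emb_lincomb)
    show ?thesis
    proof (rule bounded_linear_intro)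
      show "S s (u + v) = S s u + S s v" for u v using lin[of 1 u 1 v] by simp
      show "S s (r *\<^sub>R u) = r *\<^sub>R S s u" for r u using lin[of r u 0 u] by simp
      show "norm (S s u) \<le> norm u * K" for u
        using K[of "unemb m u"] by (simp add: norm_eq_l2_norm unemb_S that mult.commute)
    qed
  qed
  have S0: "S 0 v = v" for v
    using c0 by (simp add: S_def c0_semigroup_def)
  have Sadd: "S (s + r) v = S s (S r v)" if "s \<ge> 0" "r \<ge> 0" for s r v
    using c0 that unemb_S[OF that(2)] by (simp add: S_def[of "s + r"] S_def[of s] c0_semigroup_def)
  have Scont: "((\<lambda>s. S s v) \<longlongrightarrow> v) (at_right 0)" for v
  proof -
    have "((\<lambda>s. l2_norm m (\<lambda>x. T s (unemb m v) x - unemb m v x)) \<longlongrightarrow> 0) (at_right 0)"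
      using c0 by (simp add: c0_semigroup_def)
    moreover have "\<forall>\<^sub>F s in at_right 0. l2_norm m (\<lambda>x. T s (unemb m v) x - unemb m v x) = norm (S s v - v)"
      using eventually_at_right_less[of 0] by eventually_elim (simp add: diff unemb_S)
    ultimately have "((\<lambda>s. norm (S s v - v)) \<longlongrightarrow> 0) (at_right 0)"
      by (rule Lim_transform_eventually)
    then show ?thesis
      by (simp add: tendsto_norm_zero_iff LIM_zero_iff)
  qed
  \<comment> \<open>Both directions matter: one supplies the derivative at time 0 on the domain, the
    other shows that the semigroup leaves the domain invariant.\<close>
  have Sgen: "((\<lambda>s. (S s v - v) /\<^sub>R s) \<longlongrightarrow> h) (at_right 0) \<longleftrightarrow> v \<in> seq_dom \<and> h = - seq_op v" for v h
  proof -
    have "((\<lambda>s. (S s v - v) /\<^sub>R s) \<longlongrightarrow> h) (at_right 0) \<longleftrightarrow>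
        ((\<lambda>s. norm ((S s v - v) /\<^sub>R s - h)) \<longlongrightarrow> 0) (at_right 0)"
      by (simp add: tendsto_norm_zero_iff LIM_zero_iff)
    also have "\<dots> \<longleftrightarrow> ((\<lambda>s. l2_norm m (\<lambda>x. (T s (unemb m v) x - unemb m v x) / s - unemb m h x)) \<longlongrightarrow> 0) (at_right 0)"
    proof (rule filterlim_cong[OF refl refl])
      show "\<forall>\<^sub>F s in at_right 0. norm ((S s v - v) /\<^sub>R s - h) =
          l2_norm m (\<lambda>x. (T s (unemb m v) x - unemb m v x) / s - unemb m h x)"
        using eventually_at_right_less[of 0]
      proof eventually_elim
        case (elim s)
        have "unemb m ((S s v - v) /\<^sub>R s) = (\<lambda>x. (T s (unemb m v) x - unemb m v x) / s)"
          using unemb_lincomb[of m "1 / s" "S s v" "- 1 / s" v] unemb_S[of s v] elim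
          by (simp add: scaleR_diff_right inverse_eq_divide diff_divide_distrib)
        then show ?case by (simp add: diff)
      qed
    qed
    also have "\<dots> \<longleftrightarrow> (unemb m v, unemb m h) \<in> generator_graph m T"
      by (simp add: generator_graph_def)
    also have "\<dots> \<longleftrightarrow> v \<in> seq_dom \<and> unemb m h = (\<lambda>x. - L (unemb m v) x)"
      by (auto simp: gen seq_dom_def)
    also have "\<dots> \<longleftrightarrow> v \<in> seq_dom \<and> unemb m h = unemb m (- seq_op v)"
      using unemb_lincomb[of m "-1" "seq_op v" 0 "seq_op v"] by (auto simp: unemb_op)
    also have "\<dots> \<longleftrightarrow> v \<in> seq_dom \<and> h = - seq_op v"
      using emb_unemb_m by metis
    finally show ?thesis .
  qed
  have op_sym: "inner (seq_op u) v = inner u (seq_op v)" if "u \<in> seq_dom" "v \<in> seq_dom" for u v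
    using op_adjoint[of u "seq_op u"] that by simp
  have decay: "S t v \<in> seq_dom" "2 * t * inner (seq_op (S t v)) (S t v) + (norm (S t v))\<^sup>2 \<le> (norm v)\<^sup>2"
    if "v \<in> seq_dom" for v
    by (rule semigroup_form_decay[OF S_bl S0 Sadd Scont Sgen op_sym that less_imp_le[OF \<open>t > 0\<close>]];
        assumption)+
  obtain C where C: "C > 0"
    "\<And>v x. v \<in> seq_dom \<Longrightarrow> \<bar>unemb m v x\<bar> \<le> C * sqrt (inner (seq_op v) v + (norm v)\<^sup>2)"
    using pointwise_bound by blast
  \<comment> \<open>The energy after time \<open>t\<close> is at most \<open>1 / (2 * t)\<close>
    times the squared norm of the initial value; the summand 1 accounts for the squared norm after
    time \<open>t\<close>.\<close>
  define K where "K = C * sqrt (1 / (2 * t) + 1)"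
  have on_dom: "\<bar>unemb m (S t v) x\<bar> \<le> K * norm v" if "v \<in> seq_dom" for v x
  proof -
    let ?u = "S t v"
    have u: "?u \<in> seq_dom" "2 * t * inner (seq_op ?u) ?u + (norm ?u)\<^sup>2 \<le> (norm v)\<^sup>2"
      using decay[OF that] by auto
    have "2 * t * inner (seq_op ?u) ?u \<ge> 0"
      using op_nonneg[OF u(1)] \<open>t > 0\<close> by simp
    then have "(norm ?u)\<^sup>2 \<le> (norm v)\<^sup>2" "2 * t * inner (seq_op ?u) ?u \<le> (norm v)\<^sup>2"
      using u(2) zero_le_power2[of "norm ?u"] by linarith+
    moreover from this(2) have "inner (seq_op ?u) ?u \<le> 1 / (2 * t) * (norm v)\<^sup>2"
      using \<open>t > 0\<close> by (simp add: pos_le_divide_eq mult_ac)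
    ultimately have "inner (seq_op ?u) ?u + (norm ?u)\<^sup>2 \<le> (1 / (2 * t) + 1) * (norm v)\<^sup>2"
      unfolding distrib_right by linarith
    from real_sqrt_le_mono[OF this]
    have "sqrt (inner (seq_op ?u) ?u + (norm ?u)\<^sup>2) \<le> sqrt (1 / (2 * t) + 1) * norm v"
      by (simp add: real_sqrt_mult)
    then have "C * sqrt (inner (seq_op ?u) ?u + (norm ?u)\<^sup>2) \<le> K * norm v"
      using C(1) by (simp add: K_def)
    then show ?thesis using C(2)[OF u(1), of x] by linarith
  qed
  have "\<bar>unemb m (S t v) x\<bar> \<le> K * norm v" for v x
  proof -
    interpret A: bounded_linear "\<lambda>v. unemb m (S t v) x"
      using \<open>t > 0\<close> by (intro bounded_linear_compose[OF bounded_linear_unemb] S_bl) simp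
    have "closed {v. \<bar>unemb m (S t v) x\<bar> \<le> K * norm v}"
      by (intro closed_Collect_le continuous_intros A.continuous_on)
    then have "closure seq_dom \<subseteq> {v. \<bar>unemb m (S t v) x\<bar> \<le> K * norm v}"
      using on_dom by (intro closure_minimal) auto
    then show ?thesis by (auto simp: seq_dom_dense)
  qed
  then have "\<bar>T t f x\<bar> \<le> K * l2_norm m f" if "f \<in> ell2 m" for f x
    using unemb_S[of t "emb m f"] \<open>t > 0\<close> that norm_emb[where w = m, OF weights_nonneg(3) that]
    by (metis less_imp_le unemb_emb_m)
  then show ?thesis
    using T_lin \<open>t > 0\<close> by (intro ultracontractiveI) auto
qed

end

text \<open>Bijectivity of the shift is part of the conclusion because \<open>the_inv_into\<close>
  is defined by a definite description: it is what makes \<open>resolvent\<close> denote the inverse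
  on all of \<open>ell2 m\<close>.\<close>

theorem lemma7p1:
  fixes b :: "'a \<Rightarrow> 'a \<Rightarrow> real" and c m :: "'a \<Rightarrow> real"
    and D :: "('a \<Rightarrow> real) set" and L :: "('a \<Rightarrow> real) \<Rightarrow> 'a \<Rightarrow> real"
  assumes "countable (UNIV :: 'a set)" and "infinite (UNIV :: 'a set)"
    and "graph b c"
    and "uniformly_transient b c"
    and "\<And>x. m x > 0"
    and "dirichlet_operator b c m D L"
  shows "(\<forall>T. exp_semigroup m D L T \<longrightarrow> (\<forall>t>0. ultracontractive m (T t))) \<and>
    (\<forall>\<alpha>>0. bij_betw (shifted_operator L \<alpha>) D (ell2 m) \<and> ultracontractive m (resolvent D L \<alpha>))"
proof -
  interpret transient_dirichlet_operator b c m D L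
    by unfold_locales (use assms in auto)
  show ?thesis
    using semigroup_ultracontractive shifted_bij resolvent_ultracontractive by blast
qed

end
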